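(* Let $\pi:(M,\varphi,\xi,\eta,g)\to(N,J,g')$ be a contact-complex Riemannian submersion. Suppose that the O'Neill tensor $A$ satisfies $A_X\varphi Y=A_{\varphi X}Y$ for any horizontal vector fields $X,Y$. If $K_{3\varphi}$ holds on $M$, then $K_3$ holds on $N$.
   Context: All manifolds and maps are $C^\infty$. An almost contact metric manifold $(M,\varphi,\xi,\eta,g)$ has a $(1,1)$-tensor field $\varphi$, a vector field $\xi$, a 1-form $\eta$ and a Riemannian metric $g$ with $\varphi^2=-I+\eta\otimes\xi$, $\eta(\xi)=1$, $g(\varphi X,\varphi Y)=g(X,Y)-\eta(X)\eta(Y)$. A contact-complex Riemannian submersion is a (surjective) Riemannian submersion $\pi:M\to N$ from an almost contact metric manifold onto an almost Hermitian manifold $(N,J,g')$ such that $J\circ d\pi=d\pi\circ\varphi$. The vertical distribution is $\mathcal V=\ker d\pi$, the horizontal distribution $\mathcal H$ is its orthogonal complement, with orthogonal projections $v,h$. It is known that $\xi$ is vertical and $\mathcal V,\mathcal H$ are $\varphi$-invariant. With $\nabla$ the Levi-Civita connection of $g$, the O'Neill tensor $A$ is $A_{\tilde X}\tilde Y=v\nabla_{h\tilde X}h\tilde Y+h\nabla_{h\tilde X}v\tilde Y$. With $R$ the $(0,4)$ Riemann curvature tensor of the Levi-Civita connection of the manifold in question: an almost contact metric manifold satisfies $K_{3\varphi}$ if $R(X,Y,Z,W)=R(\varphi X,\varphi Y,\varphi Z,\varphi W)$ for all vector fields; an almost Hermitian manifold satisfies $K_3$ if $R(X,Y,Z,W)=R(JX,JY,JZ,JW)$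 for all vector fields. *)

theory Defs
  imports "HOL-Analysis.Analysis"
begin

section \<open>Smooth maps between Euclidean spaces\<close>

text \<open>
  On an open set, a map is \<open>C\<^sup>k\<^sup>+\<^sup>1\<close> iff it is differentiable and all its directional
  derivatives are \<open>C\<^sup>k\<close>. The predicates below are only used for open sets.
\<close>

primrec Ck_on :: "nat \<Rightarrow> 'a::euclidean_space set \<Rightarrow> ('a \<Rightarrow> 'b::real_normed_vector) \<Rightarrow> bool" where
  "Ck_on 0 S f \<longleftrightarrow> continuous_on S f"
| "Ck_on (Suc k) S f \<longleftrightarrow>
     (\<forall>x\<in>S. f differentiable (at x)) \<and> (\<forall>v. Ck_on k S (\<lambda>x. frechet_derivative f (at x) v))"

definition smooth_on :: "'a::euclidean_space set \<Rightarrow> ('a \<Rightarrow> 'b::real_normed_vector) \<Rightarrow> bool" where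
  "smooth_on S f \<longleftrightarrow> (\<forall>k. Ck_on k S f)"


section \<open>Smooth manifolds\<close>

text \<open>
  The underlying space of a manifold is a whole Hausdorff, second countable type \<open>'m\<close>; the
  smooth structure is given by an atlas (not required to be maximal) of charts with values in
  the Euclidean space \<open>'e\<close>, whose dimension is the dimension of the manifold.
  A chart is a pair of an open domain and a coordinate map, which is irrelevant off the domain.
\<close>

type_synonym ('m, 'e) chart = "'m set \<times> ('m \<Rightarrow> 'e)"

abbreviation cdom :: "('m, 'e) chart \<Rightarrow> 'm set" where "cdom c \<equiv> fst c"

abbreviation cmap :: "('m, 'e) chart \<Rightarrow> 'm \<Rightarrow> 'e" where "cmap c \<equiv> snd c"

abbreviation cran :: "('m, 'e) chart \<Rightarrow> 'e set" where "cran c \<equiv> cmap c ` cdom c"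

definition cinv :: "('m, 'e) chart \<Rightarrow> 'e \<Rightarrow> 'm" where
  "cinv c = inv_into (cdom c) (cmap c)"

definition is_chart :: "('m::topological_space, 'e::euclidean_space) chart \<Rightarrow> bool" where
  "is_chart c \<longleftrightarrow>
     open (cdom c) \<and> open (cran c) \<and> homeomorphism (cdom c) (cran c) (cmap c) (cinv c)"

definition smooth_atlas ::
  "('m::{t2_space,second_countable_topology}, 'e::euclidean_space) chart set \<Rightarrow> bool" where
  "smooth_atlas A \<longleftrightarrow>
     (\<forall>c\<in>A. is_chart c) \<and> (\<Union>c\<in>A. cdom c) = UNIV \<and>
     (\<forall>c\<in>A. \<forall>d\<in>A. smooth_on (cmap c ` (cdom c \<inter> cdom d)) (cmap d \<circ> cinv c))"

definition smooth_fun ::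
  "('m, 'e::euclidean_space) chart set \<Rightarrow> ('m \<Rightarrow> real) \<Rightarrow> bool" where
  "smooth_fun A f \<longleftrightarrow> (\<forall>c\<in>A. smooth_on (cran c) (f \<circ> cinv c))"

definition smooth_map ::
  "('m::topological_space, 'e::euclidean_space) chart set \<Rightarrow>
   ('n::topological_space, 'f::euclidean_space) chart set \<Rightarrow> ('m \<Rightarrow> 'n) \<Rightarrow> bool" where
  "smooth_map A B p \<longleftrightarrow> continuous_on UNIV p \<and>
     (\<forall>c\<in>A. \<forall>d\<in>B. smooth_on (cmap c ` (cdom c \<inter> p -` cdom d)) (cmap d \<circ> p \<circ> cinv c))"


section \<open>Tangent vectors and vector fields\<close>

text \<open>
  A preferred chart \<open>chart_at A x\<close> is selected around each point \<open>x\<close>, and the tangent space at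
  \<open>x\<close> is identified with \<open>'e\<close> by taking components in that chart. The map \<open>to_chart A c x\<close> sends a
  tangent vector at \<open>x\<close> to its components in an arbitrary chart \<open>c\<close> around \<open>x\<close>, and
  \<open>from_chart A c x\<close> is its inverse. No continuity of \<open>chart_at\<close> in \<open>x\<close> is available, so
  smoothness of fields is always expressed through components in a fixed chart.
\<close>

definition chart_at :: "('m, 'e) chart set \<Rightarrow> 'm \<Rightarrow> ('m, 'e) chart" where
  "chart_at A x = (SOME c. c \<in> A \<and> x \<in> cdom c)"

definition to_chart ::
  "('m, 'e::euclidean_space) chart set \<Rightarrow> ('m, 'e) chart \<Rightarrow> 'm \<Rightarrow> 'e \<Rightarrow> 'e" where
  "to_chart A c x v =
     frechet_derivative (cmap c \<circ> cinv (chart_at A x)) (at (cmap (chart_at A x) x)) v"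

definition from_chart ::
  "('m, 'e::euclidean_space) chart set \<Rightarrow> ('m, 'e) chart \<Rightarrow> 'm \<Rightarrow> 'e \<Rightarrow> 'e" where
  "from_chart A c x u =
     frechet_derivative (cmap (chart_at A x) \<circ> cinv c) (at (cmap c x)) u"

definition vf_comp ::
  "('m, 'e::euclidean_space) chart set \<Rightarrow> ('m, 'e) chart \<Rightarrow> ('m \<Rightarrow> 'e) \<Rightarrow> 'e \<Rightarrow> 'e" where
  "vf_comp A c X y = to_chart A c (cinv c y) (X (cinv c y))"

definition vector_field ::
  "('m, 'e::euclidean_space) chart set \<Rightarrow> ('m \<Rightarrow> 'e) \<Rightarrow> bool" where
  "vector_field A X \<longleftrightarrow> (\<forall>c\<in>A. smooth_on (cran c) (vf_comp A c X))"

text \<open>The action \<open>X f\<close> of a vector field on a function.\<close>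

definition vf_apply ::
  "('m, 'e::euclidean_space) chart set \<Rightarrow> ('m \<Rightarrow> 'e) \<Rightarrow> ('m \<Rightarrow> real) \<Rightarrow> 'm \<Rightarrow> real" where
  "vf_apply A X f x =
     frechet_derivative (f \<circ> cinv (chart_at A x)) (at (cmap (chart_at A x) x)) (X x)"

text \<open>
  The coordinate formula \<open>[X, Y]\<^sup>j = \<Sum>i. X\<^sup>i \<partial>\<^sub>i Y\<^sup>j - Y\<^sup>i \<partial>\<^sub>i X\<^sup>j\<close>, in the preferred chart at \<open>x\<close>.
\<close>

definition lie_bracket ::
  "('m, 'e::euclidean_space) chart set \<Rightarrow> ('m \<Rightarrow> 'e) \<Rightarrow> ('m \<Rightarrow> 'e) \<Rightarrow> 'm \<Rightarrow> 'e" where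
  "lie_bracket A X Y x =
     (let c = chart_at A x in
        frechet_derivative (vf_comp A c Y) (at (cmap c x)) (X x) -
        frechet_derivative (vf_comp A c X) (at (cmap c x)) (Y x))"

definition differential ::
  "('m, 'e::euclidean_space) chart set \<Rightarrow> ('n, 'f::euclidean_space) chart set \<Rightarrow>
   ('m \<Rightarrow> 'n) \<Rightarrow> 'm \<Rightarrow> 'e \<Rightarrow> 'f" where
  "differential A B p x v =
     frechet_derivative (cmap (chart_at B (p x)) \<circ> p \<circ> cinv (chart_at A x))
       (at (cmap (chart_at A x) x)) v"


section \<open>Tensor fields\<close>

definition one_form ::
  "('m, 'e::euclidean_space) chart set \<Rightarrow> ('m \<Rightarrow> 'e \<Rightarrow> real) \<Rightarrow> bool" where
  "one_form A \<eta> \<longleftrightarrow>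
     (\<forall>x. linear (\<eta> x)) \<and>
     (\<forall>c\<in>A. \<forall>u. smooth_on (cran c) (\<lambda>y. \<eta> (cinv c y) (from_chart A c (cinv c y) u)))"

definition endo_field ::
  "('m, 'e::euclidean_space) chart set \<Rightarrow> ('m \<Rightarrow> 'e \<Rightarrow> 'e) \<Rightarrow> bool" where
  "endo_field A T \<longleftrightarrow>
     (\<forall>x. linear (T x)) \<and>
     (\<forall>c\<in>A. \<forall>u. smooth_on (cran c)
        (\<lambda>y. to_chart A c (cinv c y) (T (cinv c y) (from_chart A c (cinv c y) u))))"

definition riemannian_metric ::
  "('m, 'e::euclidean_space) chart set \<Rightarrow> ('m \<Rightarrow> 'e \<Rightarrow> 'e \<Rightarrow> real) \<Rightarrow> bool" where
  "riemannian_metric A g \<longleftrightarrow>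
     (\<forall>x. bilinear (g x)) \<and>
     (\<forall>x u v. g x u v = g x v u) \<and>
     (\<forall>x v. v \<noteq> 0 \<longrightarrow> g x v v > 0) \<and>
     (\<forall>c\<in>A. \<forall>u v. smooth_on (cran c)
        (\<lambda>y. g (cinv c y) (from_chart A c (cinv c y) u) (from_chart A c (cinv c y) v)))"


section \<open>Levi-Civita connection and curvature\<close>

text \<open>
  A connection is a map on pairs of smooth vector fields; its values on other arguments are
  irrelevant and unconstrained.
\<close>

definition affine_connection ::
  "('m, 'e::euclidean_space) chart set \<Rightarrow> (('m \<Rightarrow> 'e) \<Rightarrow> ('m \<Rightarrow> 'e) \<Rightarrow> ('m \<Rightarrow> 'e)) \<Rightarrow> bool" where
  "affine_connection A D \<longleftrightarrow>
     (\<forall>X Y. vector_field A X \<longrightarrow> vector_field A Y \<longrightarrow> vector_field A (D X Y)) \<and>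
     (\<forall>X X' Y. vector_field A X \<longrightarrow> vector_field A X' \<longrightarrow> vector_field A Y \<longrightarrow>
        D (\<lambda>x. X x + X' x) Y = (\<lambda>x. D X Y x + D X' Y x)) \<and>
     (\<forall>f X Y. smooth_fun A f \<longrightarrow> vector_field A X \<longrightarrow> vector_field A Y \<longrightarrow>
        D (\<lambda>x. f x *\<^sub>R X x) Y = (\<lambda>x. f x *\<^sub>R D X Y x)) \<and>
     (\<forall>X Y Y'. vector_field A X \<longrightarrow> vector_field A Y \<longrightarrow> vector_field A Y' \<longrightarrow>
        D X (\<lambda>x. Y x + Y' x) = (\<lambda>x. D X Y x + D X Y' x)) \<and>
     (\<forall>f X Y. smooth_fun A f \<longrightarrow> vector_field A X \<longrightarrow> vector_field A Y \<longrightarrow>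
        D X (\<lambda>x. f x *\<^sub>R Y x) = (\<lambda>x. vf_apply A X f x *\<^sub>R Y x + f x *\<^sub>R D X Y x))"

definition levi_civita ::
  "('m, 'e::euclidean_space) chart set \<Rightarrow> ('m \<Rightarrow> 'e \<Rightarrow> 'e \<Rightarrow> real) \<Rightarrow>
   (('m \<Rightarrow> 'e) \<Rightarrow> ('m \<Rightarrow> 'e) \<Rightarrow> ('m \<Rightarrow> 'e)) \<Rightarrow> bool" where
  "levi_civita A g D \<longleftrightarrow>
     affine_connection A D \<and>
     (\<forall>X Y. vector_field A X \<longrightarrow> vector_field A Y \<longrightarrow>
        (\<forall>x. D X Y x - D Y X x = lie_bracket A X Y x)) \<and>
     (\<forall>X Y Z. vector_field A X \<longrightarrow> vector_field A Y \<longrightarrow> vector_field A Z \<longrightarrow>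
        (\<forall>x. vf_apply A X (\<lambda>y. g y (Y y) (Z y)) x = g x (D X Y x) (Z x) + g x (Y x) (D X Z x)))"

text \<open>
  Sign convention: \<open>R(X, Y, Z, W) = g(\<nabla>\<^sub>X \<nabla>\<^sub>Y Z - \<nabla>\<^sub>Y \<nabla>\<^sub>X Z - \<nabla>\<^bsub>[X, Y]\<^esub> Z, W)\<close>.
\<close>

definition curvature ::
  "('m, 'e::euclidean_space) chart set \<Rightarrow> ('m \<Rightarrow> 'e \<Rightarrow> 'e \<Rightarrow> real) \<Rightarrow>
   (('m \<Rightarrow> 'e) \<Rightarrow> ('m \<Rightarrow> 'e) \<Rightarrow> ('m \<Rightarrow> 'e)) \<Rightarrow>
   ('m \<Rightarrow> 'e) \<Rightarrow> ('m \<Rightarrow> 'e) \<Rightarrow> ('m \<Rightarrow> 'e) \<Rightarrow> ('m \<Rightarrow> 'e) \<Rightarrow> 'm \<Rightarrow> real" where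
  "curvature A g D X Y Z W x =
     g x (D X (D Y Z) x - D Y (D X Z) x - D (lie_bracket A X Y) Z x) (W x)"

definition curvature_invariant ::
  "('m, 'e::euclidean_space) chart set \<Rightarrow> ('m \<Rightarrow> 'e \<Rightarrow> 'e \<Rightarrow> real) \<Rightarrow>
   (('m \<Rightarrow> 'e) \<Rightarrow> ('m \<Rightarrow> 'e) \<Rightarrow> ('m \<Rightarrow> 'e)) \<Rightarrow> ('m \<Rightarrow> 'e \<Rightarrow> 'e) \<Rightarrow> bool" where
  "curvature_invariant A g D T \<longleftrightarrow>
     (\<forall>X Y Z W. vector_field A X \<longrightarrow> vector_field A Y \<longrightarrow> vector_field A Z \<longrightarrow> vector_field A W \<longrightarrow>
        (\<forall>x. curvature A g D X Y Z W x =
             curvature A g D (\<lambda>y. T y (X y)) (\<lambda>y. T y (Y y)) (\<lambda>y. T y (Z y)) (\<lambda>y. T y (W y)) x))"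

text \<open>
  The conditions \<open>K\<^bsub>3\<phi>\<^esub>\<close> (almost contact metric) and \<open>K\<^sub>3\<close> (almost Hermitian) differ only in
  which endomorphism field is meant.
\<close>

definition K3phi ::
  "('m, 'e::euclidean_space) chart set \<Rightarrow> ('m \<Rightarrow> 'e \<Rightarrow> 'e) \<Rightarrow> ('m \<Rightarrow> 'e \<Rightarrow> 'e \<Rightarrow> real) \<Rightarrow>
   (('m \<Rightarrow> 'e) \<Rightarrow> ('m \<Rightarrow> 'e) \<Rightarrow> ('m \<Rightarrow> 'e)) \<Rightarrow> bool" where
  "K3phi A \<phi> g D \<longleftrightarrow> curvature_invariant A g D \<phi>"

definition K3 ::
  "('n, 'f::euclidean_space) chart set \<Rightarrow> ('n \<Rightarrow> 'f \<Rightarrow> 'f) \<Rightarrow> ('n \<Rightarrow> 'f \<Rightarrow> 'f \<Rightarrow> real) \<Rightarrow>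
   (('n \<Rightarrow> 'f) \<Rightarrow> ('n \<Rightarrow> 'f) \<Rightarrow> ('n \<Rightarrow> 'f)) \<Rightarrow> bool" where
  "K3 B J g' D \<longleftrightarrow> curvature_invariant B g' D J"


section \<open>Almost contact metric and almost Hermitian manifolds\<close>

definition almost_contact_metric ::
  "('m::{t2_space,second_countable_topology}, 'e::euclidean_space) chart set \<Rightarrow>
   ('m \<Rightarrow> 'e \<Rightarrow> 'e) \<Rightarrow> ('m \<Rightarrow> 'e) \<Rightarrow> ('m \<Rightarrow> 'e \<Rightarrow> real) \<Rightarrow> ('m \<Rightarrow> 'e \<Rightarrow> 'e \<Rightarrow> real) \<Rightarrow> bool" where
  "almost_contact_metric A \<phi> \<xi> \<eta> g \<longleftrightarrow>
     smooth_atlas A \<and> endo_field A \<phi> \<and> vector_field A \<xi> \<and> one_form A \<eta> \<and> riemannian_metric A g \<and>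
     (\<forall>x v. \<phi> x (\<phi> x v) = - v + \<eta> x v *\<^sub>R \<xi> x) \<and>
     (\<forall>x. \<eta> x (\<xi> x) = 1) \<and>
     (\<forall>x u v. g x (\<phi> x u) (\<phi> x v) = g x u v - \<eta> x u * \<eta> x v)"

definition almost_hermitian ::
  "('n::{t2_space,second_countable_topology}, 'f::euclidean_space) chart set \<Rightarrow>
   ('n \<Rightarrow> 'f \<Rightarrow> 'f) \<Rightarrow> ('n \<Rightarrow> 'f \<Rightarrow> 'f \<Rightarrow> real) \<Rightarrow> bool" where
  "almost_hermitian B J g' \<longleftrightarrow>
     smooth_atlas B \<and> endo_field B J \<and> riemannian_metric B g' \<and>
     (\<forall>x v. J x (J x v) = - v) \<and>
     (\<forall>x u v. g' x (J x u) (J x v) = g' x u v)"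


section \<open>Riemannian submersions\<close>

definition vertical ::
  "('m, 'e::euclidean_space) chart set \<Rightarrow> ('n, 'f::euclidean_space) chart set \<Rightarrow>
   ('m \<Rightarrow> 'n) \<Rightarrow> 'm \<Rightarrow> 'e set" where
  "vertical A B p x = {v. differential A B p x v = 0}"

definition horizontal ::
  "('m, 'e::euclidean_space) chart set \<Rightarrow> ('n, 'f::euclidean_space) chart set \<Rightarrow>
   ('m \<Rightarrow> 'e \<Rightarrow> 'e \<Rightarrow> real) \<Rightarrow> ('m \<Rightarrow> 'n) \<Rightarrow> 'm \<Rightarrow> 'e set" where
  "horizontal A B g p x = {u. \<forall>v \<in> vertical A B p x. g x u v = 0}"

definition riemannian_submersion ::
  "('m::topological_space, 'e::euclidean_space) chart set \<Rightarrow>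
   ('n::topological_space, 'f::euclidean_space) chart set \<Rightarrow>
   ('m \<Rightarrow> 'e \<Rightarrow> 'e \<Rightarrow> real) \<Rightarrow> ('n \<Rightarrow> 'f \<Rightarrow> 'f \<Rightarrow> real) \<Rightarrow> ('m \<Rightarrow> 'n) \<Rightarrow> bool" where
  "riemannian_submersion A B g g' p \<longleftrightarrow>
     smooth_map A B p \<and> surj p \<and>
     (\<forall>x. surj (differential A B p x)) \<and>
     (\<forall>x. \<forall>u \<in> horizontal A B g p x. \<forall>v \<in> horizontal A B g p x.
        g' (p x) (differential A B p x u) (differential A B p x v) = g x u v)"

definition contact_complex_submersion ::
  "('m::{t2_space,second_countable_topology}, 'e::euclidean_space) chart set \<Rightarrow>
   ('m \<Rightarrow> 'e \<Rightarrow> 'e) \<Rightarrow> ('m \<Rightarrow> 'e) \<Rightarrow> ('m \<Rightarrow> 'e \<Rightarrow> real) \<Rightarrow> ('m \<Rightarrow> 'e \<Rightarrow> 'e \<Rightarrow> real) \<Rightarrow>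
   ('n::{t2_space,second_countable_topology}, 'f::euclidean_space) chart set \<Rightarrow>
   ('n \<Rightarrow> 'f \<Rightarrow> 'f) \<Rightarrow> ('n \<Rightarrow> 'f \<Rightarrow> 'f \<Rightarrow> real) \<Rightarrow> ('m \<Rightarrow> 'n) \<Rightarrow> bool" where
  "contact_complex_submersion A \<phi> \<xi> \<eta> g B J g' p \<longleftrightarrow>
     almost_contact_metric A \<phi> \<xi> \<eta> g \<and> almost_hermitian B J g' \<and>
     riemannian_submersion A B g g' p \<and>
     (\<forall>x v. J (p x) (differential A B p x v) = differential A B p x (\<phi> x v))"

text \<open>The orthogonal projections \<open>v\<close> and \<open>h\<close>, acting on vector fields.\<close>

definition vproj ::
  "('m, 'e::euclidean_space) chart set \<Rightarrow> ('n, 'f::euclidean_space) chart set \<Rightarrow>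
   ('m \<Rightarrow> 'e \<Rightarrow> 'e \<Rightarrow> real) \<Rightarrow> ('m \<Rightarrow> 'n) \<Rightarrow> ('m \<Rightarrow> 'e) \<Rightarrow> 'm \<Rightarrow> 'e" where
  "vproj A B g p X x = (THE u. u \<in> vertical A B p x \<and> X x - u \<in> horizontal A B g p x)"

definition hproj ::
  "('m, 'e::euclidean_space) chart set \<Rightarrow> ('n, 'f::euclidean_space) chart set \<Rightarrow>
   ('m \<Rightarrow> 'e \<Rightarrow> 'e \<Rightarrow> real) \<Rightarrow> ('m \<Rightarrow> 'n) \<Rightarrow> ('m \<Rightarrow> 'e) \<Rightarrow> 'm \<Rightarrow> 'e" where
  "hproj A B g p X x = (THE u. u \<in> horizontal A B g p x \<and> X x - u \<in> vertical A B p x)"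

definition oneill_A ::
  "('m, 'e::euclidean_space) chart set \<Rightarrow> ('n, 'f::euclidean_space) chart set \<Rightarrow>
   ('m \<Rightarrow> 'e \<Rightarrow> 'e \<Rightarrow> real) \<Rightarrow> (('m \<Rightarrow> 'e) \<Rightarrow> ('m \<Rightarrow> 'e) \<Rightarrow> ('m \<Rightarrow> 'e)) \<Rightarrow> ('m \<Rightarrow> 'n) \<Rightarrow>
   ('m \<Rightarrow> 'e) \<Rightarrow> ('m \<Rightarrow> 'e) \<Rightarrow> 'm \<Rightarrow> 'e" where
  "oneill_A A B g D p X Y =
     (let v = vproj A B g p; h = hproj A B g p
      in (\<lambda>x. v (D (h X) (h Y)) x + h (D (h X) (v Y)) x))"

definition horizontal_field ::
  "('m, 'e::euclidean_space) chart set \<Rightarrow> ('n, 'f::euclidean_space) chart set \<Rightarrow>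
   ('m \<Rightarrow> 'e \<Rightarrow> 'e \<Rightarrow> real) \<Rightarrow> ('m \<Rightarrow> 'n) \<Rightarrow> ('m \<Rightarrow> 'e) \<Rightarrow> bool" where
  "horizontal_field A B g p X \<longleftrightarrow> vector_field A X \<and> (\<forall>x. X x \<in> horizontal A B g p x)"

end

theory Submission
  imports Defs "HOL-Computational_Algebra.Polynomial"
begin

text \<open>
  Lift vector fields on \<open>N\<close> horizontally to \<open>M\<close>. By the Koszul formula and the naturality of the Lie
  bracket, \<open>\<nabla>\<close> of two lifts is the lift of \<open>\<nabla>'\<close> plus the vertical term \<open>A\<close>, which gives O'Neill's formula
  \<open>R(X, Y, Z, W) = R'(X, Y, Z, W) - g(A_Y Z, A_X W) + g(A_X Z, A_Y W) + g(A_X Y - A_Y X, A_Z W)\<close>.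
  Since \<open>\<xi>\<close> is vertical, the lift of \<open>J X\<close> is \<open>\<phi>\<close> applied to the lift of \<open>X\<close>, and \<open>\<phi>\<^sup>2 = - I\<close> on horizontal
  vectors. The hypothesis thus yields \<open>A_(\<phi>X) (\<phi>Y) = A_X (\<phi>\<^sup>2 Y) = - A_X Y\<close>, so the correction terms, being
  quadratic in \<open>A\<close>, do not change under \<open>\<phi>\<close>.
\<close>

section \<open>Calculus of smooth maps\<close>

text \<open>\<open>K3\<close> on N, \<open>K3phi\<close> on M and the hypothesis on A all speak of
  global fields. Horizontal lifts connect them as soon as lifts are known to be smooth, and this is
  the main analytic cost: a lift is defined pointwise by linear algebra, and the preferred charts
  vary with the point without any continuity. In fixed charts the lift is therefore exhibited as
  part of the solution of a nonsingular linear system with smooth coefficients, and the regularity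
  of such solutions is proved directly, by freezing the coefficients at a point. A second obstacle
  is that a connection accepts global fields only, so testing an identity against an arbitrary
  tangent vector requires a bump function that extends this vector. Symmetry of second derivatives
  is what makes the Lie bracket natural: it cancels the Hessian of the submersion.\<close>

lemma Ck_on_cong:
  assumes "open S" "\<And>x. x \<in> S \<Longrightarrow> f x = g x" "Ck_on k S f"
  shows "Ck_on k S g"
  using assms(2,3)
proof (induction k arbitrary: f g)
  case 0
  then show ?case by (simp cong: continuous_on_cong)
next
  case (Suc k)
  have d: "g differentiable at x" if "x \<in> S" for x
  proof -
    have "f differentiable at x" using Suc.prems(2) that by simp
    then obtain f' where "(f has_derivative f') (at x)" by (auto simp: differentiable_def)
    then have "(g has_derivative f') (at x)"
      by (rule has_derivative_transform_within_open[OF _ assms(1) that]) (use Suc.prems(1) in auto)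
    then show ?thesis by (auto simp: differentiable_def)
  qed
  have e: "frechet_derivative f (at x) = frechet_derivative g (at x)" if "x \<in> S" for x
    using frechet_derivative_transform_within_open[of f x S g] Suc.prems that assms(1) by auto
  have "Ck_on k S (\<lambda>x. frechet_derivative g (at x) v)" for v
    by (rule Suc.IH[of "\<lambda>x. frechet_derivative f (at x) v"]) (use e Suc.prems in auto)
  with d show ?case by simp
qed

lemma Ck_on_subset: "Ck_on k S f \<Longrightarrow> T \<subseteq> S \<Longrightarrow> Ck_on k T f"
  by (induction k arbitrary: f) (auto intro: continuous_on_subset)

lemma Ck_on_Suc_D: "Ck_on (Suc k) S f \<Longrightarrow> Ck_on k S f"
  by (induction k arbitrary: f)
     (auto intro!: continuous_at_imp_continuous_on differentiable_imp_continuous_within)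

text \<open>Derivatives are taken \<open>at x\<close>, not within the set, so every level of the
  recursion is a local condition. This serves fields given by different formulas near different
  points.\<close>

lemma Ck_on_local:
  assumes "open S" "\<And>x. x \<in> S \<Longrightarrow> \<exists>U. open U \<and> x \<in> U \<and> Ck_on k U f"
  shows "Ck_on k S f"
  using assms(2)
proof (induction k arbitrary: f)
  case 0
  have "isCont f x" if "x \<in> S" for x
    using 0[OF that] by (auto simp: continuous_on_eq_continuous_at)
  then show ?case by (auto intro: continuous_at_imp_continuous_on)
next
  case (Suc k)
  have "Ck_on k S (\<lambda>x. frechet_derivative f (at x) v)" for v
  proof (rule Suc.IH)
    fix x assume "x \<in> S"
    then obtain U where "open U" "x \<in> U" "Ck_on (Suc k) U f" using Suc.prems by blast
    then show "\<exists>U. open U \<and> x \<in> U \<and> Ck_on k U (\<lambda>x. frechet_derivative f (at x) v)" by auto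
  qed
  moreover have "f differentiable at x" if "x \<in> S" for x
    using Suc.prems[OF that] by auto
  ultimately show ?case by simp
qed

lemma Ck_on_const [simp]: "Ck_on k S (\<lambda>x. c)"
  by (induction k arbitrary: c) auto

lemma Ck_on_linear:
  assumes "bounded_linear f"
  shows "Ck_on k S f"
proof (cases k)
  case 0
  then show ?thesis using assms by (simp add: linear_continuous_on)
next
  case (Suc m)
  have "(f has_derivative f) (at x)" for x
    by (rule bounded_linear_imp_has_derivative[OF assms])
  then have "f differentiable at x" "frechet_derivative f (at x) = f" for x
    using frechet_derivative_at[of f f, symmetric] by (auto simp: differentiable_def)
  with Suc show ?thesis by simp
qed

lemma Ck_on_bounded_linear:
  assumes "bounded_linear L" "open S" "Ck_on k S f"
  shows "Ck_on k S (\<lambda>x. L (f x))"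
  using assms(3)
proof (induction k arbitrary: f)
  case 0
  then show ?case
    by (simp add: bounded_linear.continuous_on[OF assms(1)])
next
  case (Suc k)
  have D: "((\<lambda>x. L (f x)) has_derivative (\<lambda>v. L (frechet_derivative f (at x) v))) (at x)"
    if "x \<in> S" for x
    using Suc.prems that
    by (intro bounded_linear.has_derivative[OF assms(1)]) (auto simp: frechet_derivative_works)
  have "Ck_on k S (\<lambda>x. frechet_derivative (\<lambda>x. L (f x)) (at x) v)" for v
    by (rule Ck_on_cong[OF assms(2) _ Suc.IH[of "\<lambda>x. frechet_derivative f (at x) v"]])
       (use Suc.prems in \<open>simp_all add: frechet_derivative_at[OF D, symmetric]\<close>)
  then show ?case using D by (auto simp: differentiable_def)
qed

lemma Ck_on_add:
  assumes "open S" "Ck_on k S f" "Ck_on k S g"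
  shows "Ck_on k S (\<lambda>x. f x + g x)"
  using assms(2,3)
proof (induction k arbitrary: f g)
  case 0
  then show ?case by (simp add: continuous_on_add)
next
  case (Suc k)
  have D: "((\<lambda>x. f x + g x) has_derivative
      (\<lambda>v. frechet_derivative f (at x) v + frechet_derivative g (at x) v)) (at x)"
    if "x \<in> S" for x
    using Suc.prems that by (intro has_derivative_add) (auto simp: frechet_derivative_works)
  have "Ck_on k S (\<lambda>x. frechet_derivative (\<lambda>x. f x + g x) (at x) v)" for v
    by (rule Ck_on_cong[OF assms(1) _ Suc.IH[of "\<lambda>x. frechet_derivative f (at x) v"
            "\<lambda>x. frechet_derivative g (at x) v"]])
       (use Suc.prems in \<open>simp_all add: frechet_derivative_at[OF D, symmetric]\<close>)
  then show ?case using D by (auto simp: differentiable_def)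
qed

lemma Ck_on_sum:
  assumes "open S" "\<And>i. i \<in> I \<Longrightarrow> Ck_on k S (f i)"
  shows "Ck_on k S (\<lambda>x. \<Sum>i\<in>I. f i x)"
  using assms(2)
  by (induction I rule: infinite_finite_induct) (auto intro!: Ck_on_add assms(1))

lemma Ck_on_bilinear:
  assumes "bounded_bilinear B" "open S" "Ck_on k S f" "Ck_on k S g"
  shows "Ck_on k S (\<lambda>x. B (f x) (g x))"
  using assms(3,4)
proof (induction k arbitrary: f g)
  case 0
  then show ?case by (simp add: bounded_bilinear.continuous_on[OF assms(1)])
next
  case (Suc k)
  have D: "((\<lambda>x. B (f x) (g x)) has_derivative
      (\<lambda>v. B (f x) (frechet_derivative g (at x) v) + B (frechet_derivative f (at x) v) (g x))) (at x)"
    if "x \<in> S" for x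
    using Suc.prems that
    by (intro bounded_bilinear.FDERIV[OF assms(1)]) (auto simp: frechet_derivative_works)
  have "Ck_on k S (\<lambda>x. B (f x) (frechet_derivative g (at x) v) + B (frechet_derivative f (at x) v) (g x))"
    for v
    using Suc.prems Suc.prems[THEN Ck_on_Suc_D] by (intro Ck_on_add[OF assms(2)] Suc.IH) simp_all
  then have "Ck_on k S (\<lambda>x. frechet_derivative (\<lambda>x. B (f x) (g x)) (at x) v)" for v
    by (rule Ck_on_cong[OF assms(2), rotated]) (simp add: frechet_derivative_at[OF D, symmetric])
  then show ?case using D by (auto simp: differentiable_def)
qed

lemma linear_basis_sum:
  fixes f :: "'a::euclidean_space \<Rightarrow> 'b::real_vector"
  assumes "linear f"
  shows "f v = (\<Sum>b\<in>Basis. (v \<bullet> b) *\<^sub>R f b)"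
proof -
  have "f v = f (\<Sum>b\<in>Basis. (v \<bullet> b) *\<^sub>R b)" by (simp add: euclidean_representation)
  also have "\<dots> = (\<Sum>b\<in>Basis. (v \<bullet> b) *\<^sub>R f b)"
    by (simp add: linear_sum[OF assms] linear_scale[OF assms])
  finally show ?thesis .
qed

text \<open>Regularity of an operator-valued map is expressed through its values on fixed vectors.
  Expanding the argument in \<open>Basis\<close> reduces the moving argument to finitely many
  products. Chain rule, endomorphism fields and metrics all rest on this.\<close>

lemma Ck_on_linear_apply:
  fixes L :: "'a::euclidean_space \<Rightarrow> 'b::euclidean_space \<Rightarrow> 'c::real_normed_vector"
  assumes S: "open S" and lin: "\<And>x. x \<in> S \<Longrightarrow> linear (L x)"
    and L: "\<And>e. Ck_on k S (\<lambda>x. L x e)" and w: "Ck_on k S w"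
  shows "Ck_on k S (\<lambda>x. L x (w x))"
proof -
  have "Ck_on k S (\<lambda>x. \<Sum>b\<in>Basis. (w x \<bullet> b) *\<^sub>R L x b)"
    by (intro Ck_on_sum S Ck_on_bilinear[OF bounded_bilinear_scaleR] L
        Ck_on_bounded_linear[OF bounded_linear_inner_left] w)
  then show ?thesis
    by (rule Ck_on_cong[OF S, rotated]) (metis linear_basis_sum[OF lin])
qed

text \<open>The derivative of the composite is a point-dependent linear map, C^k by induction for
  the derivative of f, applied to the derivative of g; \<open>Ck_on_linear_apply\<close> combines
  the two.\<close>

lemma Ck_on_compose:
  fixes g :: "'a::euclidean_space \<Rightarrow> 'b::euclidean_space" and f :: "'b \<Rightarrow> 'c::real_normed_vector"
  assumes S: "open S" and T: "open T" and gST: "g ` S \<subseteq> T"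
    and f: "Ck_on k T f" and g: "Ck_on k S g"
  shows "Ck_on k S (\<lambda>x. f (g x))"
  using f g
proof (induction k arbitrary: f)
  case 0
  then show ?case using continuous_on_compose2 gST by auto
next
  case (Suc k)
  have df: "f differentiable at (g x)" if "x \<in> S" for x using Suc.prems gST that by auto
  have D: "((\<lambda>x. f (g x)) has_derivative
      (\<lambda>v. frechet_derivative f (at (g x)) (frechet_derivative g (at x) v))) (at x)"
    if "x \<in> S" for x
    using Suc.prems gST that
    by (intro has_derivative_compose[where f=g and g=f]) (auto simp: frechet_derivative_works)
  have "Ck_on k S (\<lambda>x. frechet_derivative f (at (g x)) (frechet_derivative g (at x) v))" for v
  proof (rule Ck_on_linear_apply[OF S])
    show "linear (frechet_derivative f (at (g x)))" if "x \<in> S" for x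
      by (rule linear_frechet_derivative[OF df[OF that]])
    show "Ck_on k S (\<lambda>x. frechet_derivative f (at (g x)) e)" for e
      using Suc.IH[of "\<lambda>y. frechet_derivative f (at y) e"] Suc.prems(1) Ck_on_Suc_D[OF Suc.prems(2)]
      by simp
  qed (use Suc.prems in auto)
  then have "Ck_on k S (\<lambda>x. frechet_derivative (\<lambda>x. f (g x)) (at x) v)" for v
    by (rule Ck_on_cong[OF S, rotated]) (simp add: frechet_derivative_at[OF D, symmetric])
  then show ?case using D by (auto simp: differentiable_def)
qed

section \<open>Calculus rules for smooth maps\<close>

lemma smooth_on_cong:
  "open S \<Longrightarrow> (\<And>x. x \<in> S \<Longrightarrow> f x = g x) \<Longrightarrow> smooth_on S f \<Longrightarrow> smooth_on S g"
  unfolding smooth_on_def using Ck_on_cong by blast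

lemma smooth_on_subset: "smooth_on S f \<Longrightarrow> T \<subseteq> S \<Longrightarrow> smooth_on T f"
  unfolding smooth_on_def using Ck_on_subset by blast

lemma smooth_on_local:
  assumes "open S" "\<And>x. x \<in> S \<Longrightarrow> \<exists>U. open U \<and> x \<in> U \<and> smooth_on U f"
  shows "smooth_on S f"
  unfolding smooth_on_def
proof
  fix k
  show "Ck_on k S f"
    by (rule Ck_on_local[OF assms(1)]) (metis assms(2) smooth_on_def)
qed

lemma smooth_on_const [simp]: "smooth_on S (\<lambda>x. c)"
  by (simp add: smooth_on_def)

lemma smooth_on_bounded_linear:
  "bounded_linear L \<Longrightarrow> open S \<Longrightarrow> smooth_on S f \<Longrightarrow> smooth_on S (\<lambda>x. L (f x))"
  by (simp add: smooth_on_def Ck_on_bounded_linear)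

lemma smooth_on_linear: "bounded_linear L \<Longrightarrow> smooth_on S L"
  by (simp add: smooth_on_def Ck_on_linear)

lemma smooth_on_add: "open S \<Longrightarrow> smooth_on S f \<Longrightarrow> smooth_on S g \<Longrightarrow> smooth_on S (\<lambda>x. f x + g x)"
  by (simp add: smooth_on_def Ck_on_add)

lemma smooth_on_diff: "open S \<Longrightarrow> smooth_on S f \<Longrightarrow> smooth_on S g \<Longrightarrow> smooth_on S (\<lambda>x. f x - g x)"
  using smooth_on_add[of S f "\<lambda>x. - g x"]
    smooth_on_bounded_linear[OF bounded_linear_minus[OF bounded_linear_ident], of S g] by simp

lemma smooth_on_sum: "open S \<Longrightarrow> (\<And>i. i \<in> I \<Longrightarrow> smooth_on S (f i)) \<Longrightarrow> smooth_on S (\<lambda>x. \<Sum>i\<in>I. f i x)"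
  by (simp add: smooth_on_def Ck_on_sum)

lemma smooth_on_bilinear:
  "bounded_bilinear B \<Longrightarrow> open S \<Longrightarrow> smooth_on S f \<Longrightarrow> smooth_on S g \<Longrightarrow> smooth_on S (\<lambda>x. B (f x) (g x))"
  by (simp add: smooth_on_def Ck_on_bilinear)

lemmas smooth_on_scaleR = smooth_on_bilinear[OF bounded_bilinear_scaleR]
lemmas smooth_on_inner = smooth_on_bilinear[OF bounded_bilinear_inner]

lemma smooth_on_linear_apply:
  fixes L :: "'a::euclidean_space \<Rightarrow> 'b::euclidean_space \<Rightarrow> 'c::real_normed_vector"
  assumes "open S" "\<And>x. x \<in> S \<Longrightarrow> linear (L x)" "\<And>e. smooth_on S (\<lambda>x. L x e)" "smooth_on S w"
  shows "smooth_on S (\<lambda>x. L x (w x))"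
  unfolding smooth_on_def
proof
  fix k
  show "Ck_on k S (\<lambda>x. L x (w x))"
    by (rule Ck_on_linear_apply) (use assms in \<open>simp_all add: smooth_on_def\<close>)
qed

lemma smooth_on_compose:
  fixes g :: "'a::euclidean_space \<Rightarrow> 'b::euclidean_space" and f :: "'b \<Rightarrow> 'c::real_normed_vector"
  assumes "open S" "open T" "g ` S \<subseteq> T" "smooth_on T f" "smooth_on S g"
  shows "smooth_on S (\<lambda>x. f (g x))"
  using assms unfolding smooth_on_def by (blast intro: Ck_on_compose)

lemma smooth_on_Pair:
  assumes "open S" "smooth_on S f" "smooth_on S g"
  shows "smooth_on S (\<lambda>x. (f x, g x))"
proof -
  have "smooth_on S (\<lambda>x. (f x, 0) + (0, g x))"
    by (intro smooth_on_add assms smooth_on_bounded_linear[of "\<lambda>a. (a, 0)"]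
        smooth_on_bounded_linear[of "\<lambda>a. (0, a)"] bounded_linear_Pair
        bounded_linear_ident bounded_linear_zero)
  then show ?thesis by simp
qed

lemma smooth_on_continuous: "smooth_on S f \<Longrightarrow> continuous_on S f"
  unfolding smooth_on_def by (metis Ck_on.simps(1))

lemma smooth_on_differentiable: "smooth_on S f \<Longrightarrow> x \<in> S \<Longrightarrow> f differentiable at x"
  unfolding smooth_on_def by (metis Ck_on.simps(2))

lemma smooth_on_has_derivative:
  "smooth_on S f \<Longrightarrow> x \<in> S \<Longrightarrow> (f has_derivative frechet_derivative f (at x)) (at x)"
  using smooth_on_differentiable frechet_derivative_works by blast

lemma smooth_on_frechet_derivative:
  "smooth_on S f \<Longrightarrow> smooth_on S (\<lambda>x. frechet_derivative f (at x) v)"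
  unfolding smooth_on_def by (metis Ck_on.simps(2))

section \<open>Symmetry of mixed second derivatives\<close>

lemma second_difference_mvt:
  fixes f :: "'a::euclidean_space \<Rightarrow> real"
  assumes f: "smooth_on U f" and t: "t > 0"
    and U: "\<And>s r. 0 \<le> s \<Longrightarrow> s \<le> t \<Longrightarrow> 0 \<le> r \<Longrightarrow> r \<le> t \<Longrightarrow> x + s *\<^sub>R v + r *\<^sub>R w \<in> U"
  shows "\<exists>s r. 0 < s \<and> s < t \<and> 0 < r \<and> r < t \<and>
    f (x + t *\<^sub>R v + t *\<^sub>R w) - f (x + t *\<^sub>R v) - f (x + t *\<^sub>R w) + f x =
    t\<^sup>2 * frechet_derivative (\<lambda>u. frechet_derivative f (at u) v) (at (x + s *\<^sub>R v + r *\<^sub>R w)) w"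
proof -
  let ?D = "\<lambda>u. frechet_derivative f (at u)"
  have d1: "((\<lambda>s. h (x + s *\<^sub>R v + r *\<^sub>R w)) has_real_derivative
      frechet_derivative h (at (x + s *\<^sub>R v + r *\<^sub>R w)) v) (at s)"
    if "smooth_on U h" "x + s *\<^sub>R v + r *\<^sub>R w \<in> U" for h :: "'a \<Rightarrow> real" and s r
  proof -
    note hd = smooth_on_has_derivative[OF that]
    have "((\<lambda>s. h (x + s *\<^sub>R v + r *\<^sub>R w)) has_derivative
      (\<lambda>a. frechet_derivative h (at (x + s *\<^sub>R v + r *\<^sub>R w)) (a *\<^sub>R v))) (at s)"
      by (rule has_derivative_compose[where g=h and f="\<lambda>s. x + s *\<^sub>R v + r *\<^sub>R w", OF _ hd])
         (auto intro!: derivative_eq_intros)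
    then show ?thesis
      by (simp add: has_field_derivative_def linear_scale[OF has_derivative_linear[OF hd]]
          mult.commute[of _ "frechet_derivative _ _ _"])
  qed
  have d2: "((\<lambda>r. h (x + s *\<^sub>R v + r *\<^sub>R w)) has_real_derivative
      frechet_derivative h (at (x + s *\<^sub>R v + r *\<^sub>R w)) w) (at r)"
    if "smooth_on U h" "x + s *\<^sub>R v + r *\<^sub>R w \<in> U" for h :: "'a \<Rightarrow> real" and s r
  proof -
    note hd = smooth_on_has_derivative[OF that]
    have "((\<lambda>r. h (x + s *\<^sub>R v + r *\<^sub>R w)) has_derivative
      (\<lambda>a. frechet_derivative h (at (x + s *\<^sub>R v + r *\<^sub>R w)) (a *\<^sub>R w))) (at r)"
      by (rule has_derivative_compose[where g=h and f="\<lambda>r. x + s *\<^sub>R v + r *\<^sub>R w", OF _ hd])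
         (auto intro!: derivative_eq_intros)
    then show ?thesis
      by (simp add: has_field_derivative_def linear_scale[OF has_derivative_linear[OF hd]]
          mult.commute[of _ "frechet_derivative _ _ _"])
  qed
  \<comment> \<open>Difference in direction w as a function of the position s along v. Its increment
    over [0, t] is the second difference; the mean value theorem in s and then in r extracts one
    factor t each time.\<close>
  let ?p = "\<lambda>s. f (x + s *\<^sub>R v + t *\<^sub>R w) - f (x + s *\<^sub>R v + 0 *\<^sub>R w)"
  have "(?p has_real_derivative ?D (x + s *\<^sub>R v + t *\<^sub>R w) v - ?D (x + s *\<^sub>R v + 0 *\<^sub>R w) v) (at s)"
    if "0 \<le> s" "s \<le> t" for s
    using that t by (intro DERIV_diff d1 f U) auto
  from MVT2[OF t this] obtain s where s: "0 < s" "s < t"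
    "?p t - ?p 0 = t * (?D (x + s *\<^sub>R v + t *\<^sub>R w) v - ?D (x + s *\<^sub>R v + 0 *\<^sub>R w) v)"
    by auto
  have "((\<lambda>r. ?D (x + s *\<^sub>R v + r *\<^sub>R w) v) has_real_derivative
      frechet_derivative (\<lambda>u. ?D u v) (at (x + s *\<^sub>R v + r *\<^sub>R w)) w) (at r)"
    if "0 \<le> r" "r \<le> t" for r
    using that s by (intro d2 smooth_on_frechet_derivative f U) auto
  from MVT2[OF t this] obtain r where r: "0 < r" "r < t"
    "?D (x + s *\<^sub>R v + t *\<^sub>R w) v - ?D (x + s *\<^sub>R v + 0 *\<^sub>R w) v
     = t * frechet_derivative (\<lambda>u. ?D u v) (at (x + s *\<^sub>R v + r *\<^sub>R w)) w"
    by auto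
  have "f (x + t *\<^sub>R v + t *\<^sub>R w) - f (x + t *\<^sub>R v) - f (x + t *\<^sub>R w) + f x = ?p t - ?p 0" by simp
  also have "\<dots> = t\<^sup>2 * frechet_derivative (\<lambda>u. ?D u v) (at (x + s *\<^sub>R v + r *\<^sub>R w)) w"
    unfolding s(3) r(3) by (simp add: power2_eq_square)
  finally show ?thesis using s(1,2) r(1,2) by blast
qed

text \<open>The second difference does not change when v and w are exchanged, so arbitrarily close
  to x some value of one mixed derivative equals some value of the other. Continuity of both at x
  then gives equality at x.\<close>

lemma symmetric_second_derivative_real:
  fixes f :: "'a::euclidean_space \<Rightarrow> real"
  assumes U: "open U" and x: "x \<in> U" and f: "smooth_on U f"
  shows "frechet_derivative (\<lambda>u. frechet_derivative f (at u) v) (at x) w =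
         frechet_derivative (\<lambda>u. frechet_derivative f (at u) w) (at x) v"
proof -
  define H where "H v w u = frechet_derivative (\<lambda>u. frechet_derivative f (at u) v) (at u) w" for v w u
  have contH: "isCont (H v w) x" for v w
    using smooth_on_continuous[OF smooth_on_frechet_derivative[OF smooth_on_frechet_derivative[OF f]]]
      U x unfolding H_def by (auto simp: continuous_on_eq_continuous_at)
  have "dist (H v w x) (H w v x) < e" if e: "e > 0" for e
  proof -
    from contH[of v w] e obtain d1 where d1: "d1 > 0" "\<And>y. dist y x < d1 \<Longrightarrow> dist (H v w y) (H v w x) < e/2"
      unfolding continuous_at_eps_delta using half_gt_zero by blast
    from contH[of w v] e obtain d2 where d2: "d2 > 0" "\<And>y. dist y x < d2 \<Longrightarrow> dist (H w v y) (H w v x) < e/2"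
      unfolding continuous_at_eps_delta using half_gt_zero by blast
    from U x obtain d3 where d3: "d3 > 0" "ball x d3 \<subseteq> U" using openE by blast
    define d where "d = min d1 (min d2 d3)"
    have d: "d > 0" using d1 d2 d3 by (simp add: d_def)
    \<comment> \<open>With this t, steps of length at most t along v and w move the point by at most
      d/2; the summand 1 keeps the denominator positive when v and w both vanish.\<close>
    define t where "t = d / (2 * (1 + norm v + norm w))"
    have pos: "1 + norm v + norm w > 0" by (smt (verit) norm_ge_zero)
    then have t: "t > 0" using d by (simp add: t_def)
    have close: "dist (x + s *\<^sub>R v + r *\<^sub>R w) x < d" if "0 \<le> s" "s \<le> t" "0 \<le> r" "r \<le> t" for s r
    proof -
      have "dist (x + s *\<^sub>R v + r *\<^sub>R w) x = norm (s *\<^sub>R v + r *\<^sub>R w)" by (simp add: dist_norm algebra_simps)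
      also have "\<dots> \<le> s * norm v + r * norm w" using that norm_triangle_ineq[of "s *\<^sub>R v" "r *\<^sub>R w"] by simp
      also have "\<dots> \<le> t * norm v + t * norm w" using that by (intro add_mono mult_right_mono) auto
      also have "\<dots> \<le> t * (1 + norm v + norm w)" using t by (simp add: algebra_simps)
      also have "\<dots> = d / 2" using pos unfolding t_def
        by (metis (no_types, lifting) divide_divide_eq_left less_irrefl nonzero_eq_divide_eq)
      also have "\<dots> < d" using d by simp
      finally show ?thesis .
    qed
    have inU: "x + s *\<^sub>R v + r *\<^sub>R w \<in> U" if "0 \<le> s" "s \<le> t" "0 \<le> r" "r \<le> t" for s r
      using close[OF that] d3 by (auto simp: d_def dist_commute)
    then have inU': "x + s *\<^sub>R w + r *\<^sub>R v \<in> U" if "0 \<le> s" "s \<le> t" "0 \<le> r" "r \<le> t" for s r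
      using that by (metis add.assoc add.commute)
    obtain s r where sr: "0 < s" "s < t" "0 < r" "r < t"
      "f (x + t *\<^sub>R v + t *\<^sub>R w) - f (x + t *\<^sub>R v) - f (x + t *\<^sub>R w) + f x =
       t\<^sup>2 * H v w (x + s *\<^sub>R v + r *\<^sub>R w)"
      using second_difference_mvt[OF f t inU] unfolding H_def by blast
    obtain s' r' where sr': "0 < s'" "s' < t" "0 < r'" "r' < t"
      "f (x + t *\<^sub>R w + t *\<^sub>R v) - f (x + t *\<^sub>R w) - f (x + t *\<^sub>R v) + f x =
       t\<^sup>2 * H w v (x + s' *\<^sub>R w + r' *\<^sub>R v)"
      using second_difference_mvt[OF f t inU'] unfolding H_def by blast
    have eq: "H v w (x + s *\<^sub>R v + r *\<^sub>R w) = H w v (x + s' *\<^sub>R w + r' *\<^sub>R v)"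
      using sr(5) sr'(5) t by (simp add: algebra_simps)
    have "dist (x + s *\<^sub>R v + r *\<^sub>R w) x < d" using close sr by simp
    then have 1: "dist (H v w (x + s *\<^sub>R v + r *\<^sub>R w)) (H v w x) < e/2" using d1 by (simp add: d_def)
    have "dist (x + s' *\<^sub>R w + r' *\<^sub>R v) x < d" using close[of r' s'] sr' by (simp add: ac_simps)
    then have 2: "dist (H w v (x + s' *\<^sub>R w + r' *\<^sub>R v)) (H w v x) < e/2" using d2 by (simp add: d_def)
    show ?thesis using 1 2 eq by (metis dist_commute dist_triangle_half_r)
  qed
  then have "H v w x = H w v x" by (metis dist_eq_0_iff less_irrefl zero_less_dist_iff)
  then show ?thesis by (simp add: H_def)
qed

lemma frechet_derivative_bounded_linear:
  assumes "bounded_linear L" "f differentiable at x"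
  shows "frechet_derivative (\<lambda>u. L (f u)) (at x) = (\<lambda>v. L (frechet_derivative f (at x) v))"
  by (rule frechet_derivative_at[symmetric], rule bounded_linear.has_derivative[OF assms(1)])
     (use assms(2) frechet_derivative_works in blast)

lemma symmetric_second_derivative:
  fixes f :: "'a::euclidean_space \<Rightarrow> 'b::euclidean_space"
  assumes U: "open U" and x: "x \<in> U" and f: "smooth_on U f"
  shows "frechet_derivative (\<lambda>u. frechet_derivative f (at u) v) (at x) w =
         frechet_derivative (\<lambda>u. frechet_derivative f (at u) w) (at x) v"
proof (rule euclidean_eqI)
  fix b :: 'b
  note bl = bounded_linear_inner_left[of b]
  have *: "frechet_derivative (\<lambda>u. frechet_derivative (\<lambda>u. f u \<bullet> b) (at u) v) (at x) w =
         frechet_derivative (\<lambda>u. frechet_derivative f (at u) v) (at x) w \<bullet> b" for v w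
  proof -
    have s: "smooth_on U (\<lambda>u. frechet_derivative f (at u) v)"
      by (rule smooth_on_frechet_derivative[OF f])
    have e: "frechet_derivative (\<lambda>u. f u \<bullet> b) (at u) v = frechet_derivative f (at u) v \<bullet> b" if "u \<in> U" for u
      using frechet_derivative_bounded_linear[OF bl smooth_on_differentiable[OF f that]] by metis
    have "frechet_derivative (\<lambda>u. frechet_derivative f (at u) v \<bullet> b) (at x) =
      frechet_derivative (\<lambda>u. frechet_derivative (\<lambda>u. f u \<bullet> b) (at u) v) (at x)"
      by (rule frechet_derivative_transform_within_open[OF _ U x])
         (use e smooth_on_differentiable[OF smooth_on_bounded_linear[OF bl U s] x] in auto)
    then show ?thesis
      using frechet_derivative_bounded_linear[OF bl smooth_on_differentiable[OF s x]] by metis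
  qed
  show "frechet_derivative (\<lambda>u. frechet_derivative f (at u) v) (at x) w \<bullet> b =
         frechet_derivative (\<lambda>u. frechet_derivative f (at u) w) (at x) v \<bullet> b"
    using symmetric_second_derivative_real[OF U x smooth_on_bounded_linear[OF bl U f], of v w]
    by (simp only: *)
qed


section \<open>Smooth solutions of linear systems and bump functions\<close>

text \<open>Since h vanishes at x, it is O(|y - x|), so (c y - c x) h y is o(|y - x|) although c is
  merely continuous. In \<open>differentiable_solve\<close>, c is a coordinate of the unknown, of
  which only continuity is known at that stage.\<close>

lemma differentiable_scaleR_vanishing:
  fixes c :: "'a::real_normed_vector \<Rightarrow> real" and h :: "'a \<Rightarrow> 'b::real_normed_vector"
  assumes c: "isCont c x" and h: "h differentiable at x" and h0: "h x = 0"
  shows "(\<lambda>u. c u *\<^sub>R h u) differentiable at x"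
proof -
  obtain h' where h': "(h has_derivative h') (at x)" using h by (auto simp: differentiable_def)
  then have bl: "bounded_linear h'" by (rule has_derivative_bounded_linear)
  obtain K where K: "K > 0" "\<And>v. norm (h' v) \<le> norm v * K"
    using bounded_linear.pos_bounded[OF bl] by blast
  have "((\<lambda>u. (c u - c x) *\<^sub>R h u) has_derivative (\<lambda>v. 0)) (at x)"
    unfolding has_derivative_at_alt
  proof (intro conjI allI impI)
    fix e :: real assume e: "e > 0"
    obtain d1 where d1: "d1 > 0" "\<And>y. norm (y - x) < d1 \<Longrightarrow> norm (h y - h x - h' (y - x)) \<le> 1 * norm (y - x)"
      using h' unfolding has_derivative_at_alt by (meson zero_less_one)
    obtain d2 where d2: "d2 > 0" "\<And>y. dist y x < d2 \<Longrightarrow> dist (c y) (c x) < e / (1 + K)"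
      using c e K(1) unfolding continuous_at_eps_delta by (metis add_pos_pos divide_pos_pos zero_less_one)
    show "\<exists>d>0. \<forall>y. norm (y - x) < d \<longrightarrow>
        norm ((c y - c x) *\<^sub>R h y - (c x - c x) *\<^sub>R h x - 0) \<le> e * norm (y - x)"
    proof (intro exI[of _ "min d1 d2"] conjI allI impI)
      fix y assume y: "norm (y - x) < min d1 d2"
      have "norm (h y) \<le> norm (h y - h x - h' (y - x)) + norm (h' (y - x))"
        using h0 norm_triangle_sub[of "h y" "h' (y - x)"] by (simp add: add.commute)
      also have "\<dots> \<le> 1 * norm (y - x) + norm (y - x) * K"
        using y by (intro add_mono d1(2) K(2)) simp
      finally have 1: "norm (h y) \<le> norm (y - x) * (1 + K)" by (simp add: algebra_simps)
      have "\<bar>c y - c x\<bar> < e / (1 + K)" using d2(2)[of y] y by (simp add: dist_norm)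
      then have "\<bar>c y - c x\<bar> * norm (h y) \<le> e / (1 + K) * (norm (y - x) * (1 + K))"
        using 1 e K(1) by (intro mult_mono) auto
      also have "\<dots> = e * norm (y - x)" using K(1) by simp
      finally show "norm ((c y - c x) *\<^sub>R h y - (c x - c x) *\<^sub>R h x - 0) \<le> e * norm (y - x)" by simp
    qed (use d1 d2 in auto)
  qed auto
  then have "((\<lambda>u. (c u - c x) *\<^sub>R h u + c x *\<^sub>R h u) has_derivative (\<lambda>v. 0 + c x *\<^sub>R h' v)) (at x)"
    by (intro has_derivative_add has_derivative_scaleR_right h')
  then show ?thesis unfolding differentiable_def by (auto simp: scaleR_add_left[symmetric])
qed

lemma has_derivative_linear_apply:
  fixes L :: "'a::euclidean_space \<Rightarrow> 'b::euclidean_space \<Rightarrow> 'c::euclidean_space"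
  assumes S: "open S" and lin: "\<And>u. u \<in> S \<Longrightarrow> linear (L u)"
    and smooth: "\<And>z. smooth_on S (\<lambda>u. L u z)" and x: "x \<in> S" and w: "w differentiable at x"
  shows "((\<lambda>u. L u (w u)) has_derivative
    (\<lambda>v. L x (frechet_derivative w (at x) v) + frechet_derivative (\<lambda>u. L u (w x)) (at x) v)) (at x)"
proof -
  let ?D = "\<lambda>e. frechet_derivative (\<lambda>u. L u e) (at x)"
  have hD: "((\<lambda>u. L u e) has_derivative ?D e) (at x)" for e
    by (rule smooth_on_has_derivative[OF smooth x])
  have "((\<lambda>u. \<Sum>e\<in>Basis. (w x \<bullet> e) *\<^sub>R L u e) has_derivative (\<lambda>v. \<Sum>e\<in>Basis. (w x \<bullet> e) *\<^sub>R ?D e v)) (at x)"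
    by (intro has_derivative_sum has_derivative_scaleR_right hD)
  then have "((\<lambda>u. L u (w x)) has_derivative (\<lambda>v. \<Sum>e\<in>Basis. (w x \<bullet> e) *\<^sub>R ?D e v)) (at x)"
    by (rule has_derivative_transform_within_open[OF _ S x]) (metis linear_basis_sum[OF lin])
  then have 1: "?D (w x) = (\<lambda>v. \<Sum>e\<in>Basis. (w x \<bullet> e) *\<^sub>R ?D e v)"
    by (rule frechet_derivative_at[symmetric])
  have "((\<lambda>u. \<Sum>e\<in>Basis. (w u \<bullet> e) *\<^sub>R L u e) has_derivative
    (\<lambda>v. \<Sum>e\<in>Basis. (w x \<bullet> e) *\<^sub>R ?D e v + (frechet_derivative w (at x) v \<bullet> e) *\<^sub>R L x e)) (at x)"
    by (intro has_derivative_sum has_derivative_scaleR hD has_derivative_inner_left)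
       (use w frechet_derivative_works in blast)
  then have "((\<lambda>u. L u (w u)) has_derivative
    (\<lambda>v. \<Sum>e\<in>Basis. (w x \<bullet> e) *\<^sub>R ?D e v + (frechet_derivative w (at x) v \<bullet> e) *\<^sub>R L x e)) (at x)"
    by (rule has_derivative_transform_within_open[OF _ S x]) (metis linear_basis_sum[OF lin])
  then show ?thesis
    by (simp add: 1 sum.distrib add.commute linear_basis_sum[OF lin[OF x], of "frechet_derivative w (at x) _"])
qed

section \<open>Regularity of solutions of injective linear systems\<close>

context
  fixes S :: "'a::euclidean_space set" and L :: "'a \<Rightarrow> 'b::euclidean_space \<Rightarrow> 'c::euclidean_space"
  assumes S: "open S" and lin: "\<And>u. u \<in> S \<Longrightarrow> linear (L u)"
    and inj: "\<And>u z. u \<in> S \<Longrightarrow> L u z = 0 \<Longrightarrow> z = 0"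
    and smooth: "\<And>z. smooth_on S (\<lambda>u. L u z)"
begin

text \<open>Freeze the coefficients at x: L x (w u) equals b u minus (L u - L x) (w u), and a left
  inverse of L x recovers w u. On the right the unknown is multiplied only by differences that
  vanish at u = x.\<close>

lemma left_inverse_at:
  assumes "x \<in> S" "\<And>u. u \<in> S \<Longrightarrow> L u (w u) = b u"
  obtains B where "bounded_linear B"
    "\<And>u. u \<in> S \<Longrightarrow> w u = B (b u - (\<Sum>e\<in>Basis. (w u \<bullet> e) *\<^sub>R (L u e - L x e)))"
proof -
  have "inj (L x)" using inj[OF assms(1)] lin[OF assms(1)] by (simp add: linear_injective_0)
  then obtain B where B: "linear B" "B \<circ> L x = id"
    using linear_injective_left_inverse[OF lin[OF assms(1)]] by blast
  have "w u = B (b u - (\<Sum>e\<in>Basis. (w u \<bullet> e) *\<^sub>R (L u e - L x e)))" if u: "u \<in> S" for u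
  proof -
    have "(\<Sum>e\<in>Basis. (w u \<bullet> e) *\<^sub>R (L u e - L x e)) = L u (w u) - L x (w u)"
      unfolding linear_basis_sum[OF lin[OF u], of "w u"] linear_basis_sum[OF lin[OF assms(1)], of "w u"]
      by (simp add: scaleR_diff_right sum_subtractf)
    then have "b u - (\<Sum>e\<in>Basis. (w u \<bullet> e) *\<^sub>R (L u e - L x e)) = L x (w u)" using assms(2)[OF u] by simp
    then show ?thesis using B(2) by (metis comp_apply id_apply)
  qed
  then show ?thesis using that B(1) linear_conv_bounded_linear by blast
qed

lemma isCont_solve:
  assumes x: "x \<in> S" and eq: "\<And>u. u \<in> S \<Longrightarrow> L u (w u) = b u" and b: "isCont b x"
  shows "isCont w x"
proof -
  obtain B where B: "bounded_linear B"
    "\<And>u. u \<in> S \<Longrightarrow> w u = B (b u - (\<Sum>e\<in>Basis. (w u \<bullet> e) *\<^sub>R (L u e - L x e)))"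
    using left_inverse_at[OF x eq] by blast
  obtain K where K: "K > 0" "\<And>v. norm (B v) \<le> norm v * K"
    using bounded_linear.pos_bounded[OF B(1)] by blast
  define N where "N u = (\<Sum>e\<in>Basis. norm (L u e - L x e))" for u
  have N0: "N u \<ge> 0" for u by (simp add: N_def sum_nonneg)
  have contL: "isCont (\<lambda>u. L u e) x" for e
    using smooth_on_continuous[OF smooth] S x by (auto simp: continuous_on_eq_continuous_at)
  have "isCont N x" unfolding N_def by (intro continuous_intros contL)
  then have N: "(N \<longlongrightarrow> 0) (at x)" by (simp add: isCont_def N_def)
  have ev: "\<forall>\<^sub>F u in at x. norm (w u - w x) \<le> 2 * K * (norm (b u - b x) + norm (w x) * N u)"
  proof -
    have "\<forall>\<^sub>F u in at x. N u < 1 / (2 * K)"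
      using order_tendstoD(2)[OF N] K(1) by simp
    moreover have "\<forall>\<^sub>F u in at x. u \<in> S" using S x eventually_at_topological by blast
    ultimately show ?thesis
    proof eventually_elim
      case (elim u)
      have "w u - w x = B (b u - b x - (\<Sum>e\<in>Basis. (w u \<bullet> e) *\<^sub>R (L u e - L x e)))"
        using B(2)[OF elim(2)] B(2)[OF x] by (simp add: linear_diff[OF bounded_linear.linear[OF B(1)]])
      then have "norm (w u - w x) \<le> norm (b u - b x - (\<Sum>e\<in>Basis. (w u \<bullet> e) *\<^sub>R (L u e - L x e))) * K"
        using K(2) by metis
      also have "\<dots> \<le> (norm (b u - b x) + norm (w u) * N u) * K"
      proof (intro mult_right_mono order.trans[OF norm_triangle_ineq4] add_left_mono)
        show "norm (\<Sum>e\<in>Basis. (w u \<bullet> e) *\<^sub>R (L u e - L x e)) \<le> norm (w u) * N u"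
          unfolding N_def sum_distrib_left
          by (rule order.trans[OF norm_sum]) (auto intro!: sum_mono mult_right_mono simp: Basis_le_norm)
      qed (use K in auto)
      also have "\<dots> \<le> (norm (b u - b x) + (norm (w x) + norm (w u - w x)) * N u) * K"
        using K(1) N0 norm_triangle_sub[of "w u" "w x"] by (intro mult_right_mono add_left_mono) auto
      also have "\<dots> = (norm (b u - b x) + norm (w x) * N u) * K + norm (w u - w x) * (N u * K)"
        by (simp add: algebra_simps)
      also have "\<dots> \<le> (norm (b u - b x) + norm (w x) * N u) * K + norm (w u - w x) * (1/2)"
        using elim(1) K(1) by (intro add_left_mono mult_left_mono) (auto simp: field_simps)
      finally show ?case by (simp add: field_simps)
    qed
  qed
  have "((\<lambda>u. 2 * K * (norm (b u - b x) + norm (w x) * N u)) \<longlongrightarrow> 2 * K * (norm (b x - b x) + norm (w x) * 0)) (at x)"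
    using b by (intro tendsto_intros N) (simp_all add: isCont_def)
  then have "((\<lambda>u. 2 * K * (norm (b u - b x) + norm (w x) * N u)) \<longlongrightarrow> 0) (at x)" by simp
  then have "((\<lambda>u. w u - w x) \<longlongrightarrow> 0) (at x)"
    by (rule Lim_null_comparison[OF ev])
  then show ?thesis by (simp add: isCont_def LIM_zero_iff)
qed

lemma differentiable_solve:
  assumes x: "x \<in> S" and eq: "\<And>u. u \<in> S \<Longrightarrow> L u (w u) = b u" and b: "b differentiable at x"
  shows "w differentiable at x"
proof -
  obtain B where B: "bounded_linear B"
    "\<And>u. u \<in> S \<Longrightarrow> w u = B (b u - (\<Sum>e\<in>Basis. (w u \<bullet> e) *\<^sub>R (L u e - L x e)))"
    using left_inverse_at[OF x eq] by blast
  have "isCont w x" by (rule isCont_solve[OF x eq differentiable_imp_continuous_within[OF b]])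
  then have "(\<lambda>u. (w u \<bullet> e) *\<^sub>R (L u e - L x e)) differentiable at x" for e
    by (intro differentiable_scaleR_vanishing differentiable_diff smooth_on_differentiable[OF smooth x])
       (auto intro: continuous_intros)
  then have "(\<lambda>u. b u - (\<Sum>e\<in>Basis. (w u \<bullet> e) *\<^sub>R (L u e - L x e))) differentiable at x"
    by (intro differentiable_diff b differentiable_sum) auto
  then obtain D where "((\<lambda>u. b u - (\<Sum>e\<in>Basis. (w u \<bullet> e) *\<^sub>R (L u e - L x e))) has_derivative D) (at x)"
    by (auto simp: differentiable_def)
  from bounded_linear.has_derivative[OF B(1) this]
  have "(w has_derivative (\<lambda>v. B (D v))) (at x)"
    by (rule has_derivative_transform_within_open[OF _ S x]) (use B(2) in metis)
  then show ?thesis by (auto simp: differentiable_def)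
qed

text \<open>
  A directional derivative of the solution solves the same system with a new right-hand side that
  involves only \<open>w\<close> itself and derivatives of the data, so regularity bootstraps.
\<close>

lemma smooth_on_solve:
  assumes eq: "\<And>u. u \<in> S \<Longrightarrow> L u (w u) = b u" and b: "smooth_on S b"
  shows "smooth_on S w"
proof -
  have "Ck_on k S w" if "Ck_on k S b" "\<And>u. u \<in> S \<Longrightarrow> L u (w u) = b u" for k w b
    using that
  proof (induction k arbitrary: w b)
    case 0
    then show ?case
      using isCont_solve[of _ w b] S by (auto simp: continuous_on_eq_continuous_at)
  next
    case (Suc k)
    have dw: "w differentiable at x" if "x \<in> S" for x
      using Suc.prems that by (intro differentiable_solve[of x w b]) auto
    have wk: "Ck_on k S w" by (rule Suc.IH[OF Ck_on_Suc_D[OF Suc.prems(1)] Suc.prems(2)])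
    have "Ck_on k S (\<lambda>x. frechet_derivative w (at x) v)" for v
    proof (rule Suc.IH)
      show "L x (frechet_derivative w (at x) v) =
        frechet_derivative b (at x) v - (\<Sum>e\<in>Basis. (w x \<bullet> e) *\<^sub>R frechet_derivative (\<lambda>u. L u e) (at x) v)"
        if x: "x \<in> S" for x
      proof -
        have "((\<lambda>u. L u (w u)) has_derivative frechet_derivative b (at x)) (at x)"
          by (rule has_derivative_transform_within_open[OF _ S x])
             (use Suc.prems x frechet_derivative_works in auto)
        from has_derivative_unique[OF this has_derivative_linear_apply[OF S lin smooth x dw[OF x]]]
        have 1: "frechet_derivative b (at x) v =
          L x (frechet_derivative w (at x) v) + frechet_derivative (\<lambda>u. L u (w x)) (at x) v" by metis
        \<comment> \<open>The term with argument w x is spread over the basis because smoothness in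
          u is known only for L u e with e fixed.\<close>
        have "((\<lambda>u. \<Sum>e\<in>Basis. (w x \<bullet> e) *\<^sub>R L u e) has_derivative
            (\<lambda>v. \<Sum>e\<in>Basis. (w x \<bullet> e) *\<^sub>R frechet_derivative (\<lambda>u. L u e) (at x) v)) (at x)"
          by (intro has_derivative_sum has_derivative_scaleR_right smooth_on_has_derivative[OF smooth x])
        then have "((\<lambda>u. L u (w x)) has_derivative
            (\<lambda>v. \<Sum>e\<in>Basis. (w x \<bullet> e) *\<^sub>R frechet_derivative (\<lambda>u. L u e) (at x) v)) (at x)"
          by (rule has_derivative_transform_within_open[OF _ S x]) (metis linear_basis_sum[OF lin])
        then have "frechet_derivative (\<lambda>u. L u (w x)) (at x) v =
            (\<Sum>e\<in>Basis. (w x \<bullet> e) *\<^sub>R frechet_derivative (\<lambda>u. L u e) (at x) v)"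
          by (simp add: frechet_derivative_at[symmetric])
        with 1 show ?thesis by simp
      qed
      have 2: "Ck_on k S (\<lambda>x. (w x \<bullet> e) *\<^sub>R frechet_derivative (\<lambda>u. L u e) (at x) v)" for e
        using smooth_on_frechet_derivative[OF smooth]
        by (intro Ck_on_bilinear[OF bounded_bilinear_scaleR S]
            Ck_on_bounded_linear[OF bounded_linear_inner_left S] wk) (auto simp: smooth_on_def)
      have "Ck_on k S (\<lambda>x. frechet_derivative b (at x) v +
          - (\<Sum>e\<in>Basis. (w x \<bullet> e) *\<^sub>R frechet_derivative (\<lambda>u. L u e) (at x) v))"
        using Suc.prems(1)
        by (intro Ck_on_add Ck_on_bounded_linear[OF bounded_linear_minus[OF bounded_linear_ident]]
            Ck_on_sum S 2) simp
      then show "Ck_on k S (\<lambda>x. frechet_derivative b (at x) v -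
          (\<Sum>e\<in>Basis. (w x \<bullet> e) *\<^sub>R frechet_derivative (\<lambda>u. L u e) (at x) v))" by simp
    qed
    with dw show ?case by simp
  qed
  with assms show ?thesis unfolding smooth_on_def by blast
qed

end

text \<open>With the polynomial factor the family is closed under differentiation.\<close>

definition exp_flat :: "real poly \<Rightarrow> real \<Rightarrow> real" where
  "exp_flat p t = (if t > 0 then poly p (1 / t) * exp (- (1 / t)) else 0)"

text \<open>Under s = 1/t the limit from the right becomes that of a polynomial divided by exp s at
  infinity.\<close>

lemma exp_flat_tendsto_0: "(exp_flat p \<longlongrightarrow> 0) (at 0)"
proof -
  have "((\<lambda>s. \<Sum>i\<le>degree p. coeff p i * (s ^ i / exp s)) \<longlongrightarrow> (\<Sum>i\<le>degree p. coeff p i * 0)) at_top"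
    by (intro tendsto_intros tendsto_power_div_exp_0)
  then have *: "((\<lambda>s. poly p s * exp (- s)) \<longlongrightarrow> 0) at_top"
    by (simp add: poly_altdef exp_minus sum_distrib_right sum_divide_distrib field_simps)
  have "((\<lambda>t. poly p (inverse t) * exp (- inverse t)) \<longlongrightarrow> 0) (at_right 0)"
    by (rule filterlim_compose[OF * filterlim_inverse_at_top_right])
  moreover have "\<forall>\<^sub>F t in at_right 0. poly p (inverse t) * exp (- inverse t) = exp_flat p t"
    using eventually_at_right_less[of "0::real"]
    by eventually_elim (simp add: exp_flat_def inverse_eq_divide)
  ultimately have r: "(exp_flat p \<longlongrightarrow> 0) (at_right 0)"
    using tendsto_cong by fast
  have "\<forall>\<^sub>F t in at_left 0. 0 = exp_flat p t"
    by (auto simp: exp_flat_def eventually_at_filter)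
  then have "(exp_flat p \<longlongrightarrow> 0) (at_left 0)" using tendsto_cong tendsto_const by fast
  with r show ?thesis by (simp add: filterlim_split_at)
qed

text \<open>For t > 0 differentiation of p(1/t) exp(-1/t) produces the factor 1/t^2 and replaces p
  by p - p'; the two \<open>pCons 0\<close> are this factor. At 0 the difference quotient is again
  in the family, with \<open>pCons 0 p\<close>, and tends to 0.\<close>

lemma exp_flat_DERIV:
  "(exp_flat p has_real_derivative exp_flat (pCons 0 (pCons 0 (p - pderiv p))) t) (at t)"
proof (cases t "0::real" rule: linorder_cases)
  case greater
  have "((\<lambda>t. poly p (1 / t) * exp (- (1 / t))) has_real_derivative
    exp_flat (pCons 0 (pCons 0 (p - pderiv p))) t) (at t)"
    using greater
    by (auto intro!: derivative_eq_intros DERIV_chain2[OF poly_DERIV]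
        simp: exp_flat_def field_simps power2_eq_square)
  then show ?thesis
    by (rule has_field_derivative_transform_within_open[where S="{0<..}"])
       (use greater in \<open>auto simp: exp_flat_def\<close>)
next
  case less
  have "((\<lambda>t. 0) has_real_derivative exp_flat (pCons 0 (pCons 0 (p - pderiv p))) t) (at t)"
    using less by (auto simp: exp_flat_def)
  then show ?thesis
    by (rule has_field_derivative_transform_within_open[where S="{..<0}"])
       (use less in \<open>auto simp: exp_flat_def\<close>)
next
  case equal
  have "((\<lambda>h. (exp_flat p (0 + h) - exp_flat p 0) / h) \<longlongrightarrow> 0) (at 0)"
    by (rule Lim_transform_eventually[OF exp_flat_tendsto_0[of "pCons 0 p"]])
       (auto simp: exp_flat_def eventually_at_filter)
  then show ?thesis using equal by (simp add: DERIV_def exp_flat_def)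
qed

lemma exp_flat_smooth: "smooth_on S (exp_flat p)"
proof -
  have "Ck_on k UNIV (exp_flat p)" for k
  proof (induction k arbitrary: p)
    case 0
    then show ?case by (simp add: continuous_at_imp_continuous_on DERIV_isCont[OF exp_flat_DERIV])
  next
    case (Suc k)
    have D: "(exp_flat p has_derivative (\<lambda>v. v * exp_flat (pCons 0 (pCons 0 (p - pderiv p))) t)) (at t)" for t
      using exp_flat_DERIV[of p t] by (simp add: has_field_derivative_def mult.commute[of _ "exp_flat _ _"])
    have "Ck_on k UNIV (\<lambda>t. v * exp_flat (pCons 0 (pCons 0 (p - pderiv p))) t)" for v
      by (rule Ck_on_bounded_linear[OF bounded_linear_mult_right open_UNIV Suc])
    moreover have "exp_flat p differentiable at t" for t using D unfolding differentiable_def by blast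
    ultimately show ?case by (simp add: frechet_derivative_at[OF D, symmetric])
  qed
  then show ?thesis unfolding smooth_on_def using Ck_on_subset by blast
qed

lemma bump_function:
  fixes z0 :: "'a::euclidean_space"
  assumes "r > 0"
  shows "\<exists>\<rho>. smooth_on UNIV \<rho> \<and> \<rho> z0 = (1::real) \<and> (\<forall>z. z \<notin> cball z0 r \<longrightarrow> \<rho> z = 0)"
proof (intro exI conjI allI impI)
  \<comment> \<open>The squared distance is used because the norm is not smooth at z0; the constant
    in front normalises the value at z0 to 1.\<close>
  let ?\<rho> = "\<lambda>z. inverse (exp_flat 1 (r\<^sup>2)) * exp_flat 1 (r\<^sup>2 - (z - z0) \<bullet> (z - z0))"
  have "smooth_on UNIV (\<lambda>z. (z - z0) \<bullet> (z - z0))"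
    by (intro smooth_on_inner smooth_on_diff smooth_on_linear bounded_linear_ident smooth_on_const) auto
  then have "smooth_on UNIV (\<lambda>z. r\<^sup>2 - (z - z0) \<bullet> (z - z0))"
    by (intro smooth_on_diff smooth_on_const) auto
  then have "smooth_on UNIV (\<lambda>z. exp_flat 1 (r\<^sup>2 - (z - z0) \<bullet> (z - z0)))"
    by (rule smooth_on_compose[OF open_UNIV open_UNIV subset_UNIV exp_flat_smooth])
  then show "smooth_on UNIV ?\<rho>"
    by (rule smooth_on_bounded_linear[OF bounded_linear_mult_right open_UNIV])
  show "?\<rho> z0 = 1" using assms by (simp add: exp_flat_def)
  show "?\<rho> z = 0" if "z \<notin> cball z0 r" for z
  proof -
    have "r < norm (z - z0)" using that by (simp add: dist_norm norm_minus_commute)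
    then have "r\<^sup>2 < (norm (z - z0))\<^sup>2" using assms by (intro power_strict_mono) auto
    then show ?thesis by (simp add: exp_flat_def dot_square_norm)
  qed
qed


section \<open>Tangent maps in charts\<close>

text \<open>Tangent map read in arbitrary charts. With p = id it also covers changes of chart, so
  \<open>to_chart\<close>, \<open>from_chart\<close> and \<open>differential\<close> are all
  instances and the single chain rule \<open>tmap_compose\<close> relates them.\<close>

definition tmap :: "('m, 'e::euclidean_space) chart \<Rightarrow> ('n, 'f::euclidean_space) chart \<Rightarrow>
    ('m \<Rightarrow> 'n) \<Rightarrow> 'm \<Rightarrow> 'e \<Rightarrow> 'f" where
  "tmap c d p x = frechet_derivative (cmap d \<circ> p \<circ> cinv c) (at (cmap c x))"

lemma cinv_cmap: "is_chart c \<Longrightarrow> x \<in> cdom c \<Longrightarrow> cinv c (cmap c x) = x"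
  unfolding is_chart_def homeomorphism_def by blast

lemma cmap_cinv: "u \<in> cran c \<Longrightarrow> cmap c (cinv c u) = u"
  unfolding cinv_def by (rule f_inv_into_f)

lemma cinv_in: "u \<in> cran c \<Longrightarrow> cinv c u \<in> cdom c"
  unfolding cinv_def by (rule inv_into_into)

lemma open_chart_image:
  assumes "is_chart c" "open V"
  shows "open (cmap c ` (cdom c \<inter> V))"
proof -
  have h: "homeomorphism (cdom c) (cran c) (cmap c) (cinv c)" "open (cran c)"
    using assms(1) by (auto simp: is_chart_def)
  have "openin (top_of_set (cran c)) (cmap c ` (cdom c \<inter> V))"
    by (rule homeomorphism_imp_open_map[OF h(1)]) (use assms(2) in auto)
  then show ?thesis using h(2) openin_open_eq by blast
qed

lemma smooth_atlas_chart: "smooth_atlas A \<Longrightarrow> c \<in> A \<Longrightarrow> is_chart c"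
  by (simp add: smooth_atlas_def)

lemma open_cran: "smooth_atlas A \<Longrightarrow> c \<in> A \<Longrightarrow> open (cran c)"
  by (simp add: smooth_atlas_def is_chart_def)

lemma chart_at:
  assumes "smooth_atlas A"
  shows "chart_at A x \<in> A" "x \<in> cdom (chart_at A x)"
proof -
  have "\<exists>c. c \<in> A \<and> x \<in> cdom c" using assms unfolding smooth_atlas_def by blast
  from someI_ex[OF this] show "chart_at A x \<in> A" "x \<in> cdom (chart_at A x)"
    unfolding chart_at_def by auto
qed

lemma smooth_map_id: "smooth_atlas A \<Longrightarrow> smooth_map A A id"
  by (simp add: smooth_map_def smooth_atlas_def)

context
  fixes A :: "('m::{t2_space,second_countable_topology}, 'e::euclidean_space) chart set"
    and B :: "('n::{t2_space,second_countable_topology}, 'f::euclidean_space) chart set"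
    and p :: "'m \<Rightarrow> 'n"
  assumes A: "smooth_atlas A" and B: "smooth_atlas B" and p: "smooth_map A B p"
begin

lemma open_loc_dom: "c \<in> A \<Longrightarrow> d \<in> B \<Longrightarrow> open (cmap c ` (cdom c \<inter> p -` cdom d))"
proof (rule open_chart_image)
  assume "d \<in> B"
  then have "open (cdom d)" using B by (simp add: smooth_atlas_def is_chart_def)
  moreover have "continuous_on UNIV p" using p by (simp add: smooth_map_def)
  ultimately show "open (p -` cdom d)" using open_vimage by blast
qed (rule smooth_atlas_chart[OF A])

lemma smooth_loc_rep:
  "c \<in> A \<Longrightarrow> d \<in> B \<Longrightarrow> smooth_on (cmap c ` (cdom c \<inter> p -` cdom d)) (cmap d \<circ> p \<circ> cinv c)"
  using p by (simp add: smooth_map_def)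

lemma loc_dom_simps:
  assumes "c \<in> A" "u \<in> cmap c ` (cdom c \<inter> p -` cdom d)"
  shows "u \<in> cran c" "cinv c u \<in> cdom c" "p (cinv c u) \<in> cdom d" "cmap c (cinv c u) = u"
proof -
  obtain x where x: "x \<in> cdom c" "p x \<in> cdom d" "u = cmap c x" using assms(2) by auto
  then have "cinv c u = x" using cinv_cmap[OF smooth_atlas_chart[OF A assms(1)]] by simp
  with x show "u \<in> cran c" "cinv c u \<in> cdom c" "p (cinv c u) \<in> cdom d" "cmap c (cinv c u) = u" by auto
qed

lemma tmap_has_derivative:
  assumes "c \<in> A" "d \<in> B" "x \<in> cdom c" "p x \<in> cdom d"
  shows "((cmap d \<circ> p \<circ> cinv c) has_derivative tmap c d p x) (at (cmap c x))"
  unfolding tmap_def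
  by (rule smooth_on_has_derivative[OF smooth_loc_rep[OF assms(1,2)]]) (use assms in auto)

lemma linear_tmap:
  assumes "c \<in> A" "d \<in> B" "x \<in> cdom c" "p x \<in> cdom d"
  shows "linear (tmap c d p x)"
  using has_derivative_linear[OF tmap_has_derivative[OF assms]] .

text \<open>The coordinate expressions compose only where p stays in the domain of d, so that the
  inverse of d cancels. This set is open in the chart c, which is enough for derivatives.\<close>

lemma tmap_compose:
  fixes C :: "('k::{t2_space,second_countable_topology}, 'h::euclidean_space) chart set"
  assumes C: "smooth_atlas C" and q: "smooth_map B C q"
    and c: "c \<in> A" and d: "d \<in> B" and e: "e \<in> C"
    and x: "x \<in> cdom c" "p x \<in> cdom d" "q (p x) \<in> cdom e"
  shows "tmap c e (q \<circ> p) x v = tmap d e q (p x) (tmap c d p x v)"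
proof -
  have "((cmap e \<circ> q \<circ> cinv d) has_derivative tmap d e q (p x)) (at (cmap d (p x)))"
  proof -
    have "smooth_on (cmap d ` (cdom d \<inter> q -` cdom e)) (cmap e \<circ> q \<circ> cinv d)"
      using q d e by (simp add: smooth_map_def)
    then show ?thesis unfolding tmap_def
      by (rule smooth_on_has_derivative) (use x in auto)
  qed
  then have "((cmap e \<circ> q \<circ> cinv d) has_derivative tmap d e q (p x)) (at ((cmap d \<circ> p \<circ> cinv c) (cmap c x)))"
    using cinv_cmap[OF smooth_atlas_chart[OF A c] x(1)] by simp
  from diff_chain_at[OF tmap_has_derivative[OF c d x(1,2)] this]
  have "((cmap e \<circ> q \<circ> cinv d) \<circ> (cmap d \<circ> p \<circ> cinv c) has_derivative
      tmap d e q (p x) \<circ> tmap c d p x) (at (cmap c x))" .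
  then have "((cmap e \<circ> (q \<circ> p) \<circ> cinv c) has_derivative
      tmap d e q (p x) \<circ> tmap c d p x) (at (cmap c x))"
  proof (rule has_derivative_transform_within_open[OF _ open_loc_dom[OF c d]])
    show "cmap c x \<in> cmap c ` (cdom c \<inter> p -` cdom d)" using x by auto
    fix u assume "u \<in> cmap c ` (cdom c \<inter> p -` cdom d)"
    note u = loc_dom_simps[OF c this]
    show "((cmap e \<circ> q \<circ> cinv d) \<circ> (cmap d \<circ> p \<circ> cinv c)) u = (cmap e \<circ> (q \<circ> p) \<circ> cinv c) u"
      using cinv_cmap[OF smooth_atlas_chart[OF B d] u(3)] by simp
  qed
  from frechet_derivative_at[OF this] show ?thesis unfolding tmap_def by (metis comp_apply)
qed

end

lemma tmap_id:
  assumes A: "smooth_atlas A" and c: "c \<in> A" and x: "x \<in> cdom c"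
  shows "tmap c c id x v = v"
proof -
  have "(id has_derivative id) (at (cmap c x))" by simp
  then have "((cmap c \<circ> id \<circ> cinv c) has_derivative id) (at (cmap c x))"
    by (rule has_derivative_transform_within_open[OF _ open_cran[OF A c]]) (use x in \<open>auto simp: cmap_cinv\<close>)
  from frechet_derivative_at[OF this] show ?thesis unfolding tmap_def by (metis id_apply)
qed

lemma to_chart_tmap: "to_chart A c x = tmap (chart_at A x) c id x"
  by (rule ext) (simp add: to_chart_def tmap_def)

lemma from_chart_tmap: "from_chart A c x = tmap c (chart_at A x) id x"
  by (rule ext) (simp add: from_chart_def tmap_def)

lemma differential_tmap: "differential A B p x = tmap (chart_at A x) (chart_at B (p x)) p x"
  by (rule ext) (simp add: differential_def tmap_def)

section \<open>Vector fields and tensor fields on one manifold\<close>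

locale smooth_manifold =
  fixes A :: "('m::{t2_space,second_countable_topology}, 'e::euclidean_space) chart set"
  assumes A: "smooth_atlas A"
begin

lemmas chart = smooth_atlas_chart[OF A]
lemmas ran_open = open_cran[OF A]
lemmas at_chart = chart_at[OF A]
lemmas id_smooth = smooth_map_id[OF A]

lemma linear_to_chart: "c \<in> A \<Longrightarrow> x \<in> cdom c \<Longrightarrow> linear (to_chart A c x)"
  unfolding to_chart_tmap by (rule linear_tmap[OF A A id_smooth]) (auto simp: at_chart)

lemma linear_from_chart: "c \<in> A \<Longrightarrow> x \<in> cdom c \<Longrightarrow> linear (from_chart A c x)"
  unfolding from_chart_tmap by (rule linear_tmap[OF A A id_smooth]) (auto simp: at_chart)

lemma to_from_chart_tmap:
  "c \<in> A \<Longrightarrow> d \<in> A \<Longrightarrow> x \<in> cdom c \<Longrightarrow> x \<in> cdom d \<Longrightarrow> to_chart A c x (from_chart A d x v) = tmap d c id x v"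
  using tmap_compose[OF A A id_smooth A id_smooth, of d "chart_at A x" c x v]
  by (simp add: to_chart_tmap from_chart_tmap at_chart)

lemma to_from_chart: "c \<in> A \<Longrightarrow> x \<in> cdom c \<Longrightarrow> to_chart A c x (from_chart A c x v) = v"
  by (simp add: to_from_chart_tmap tmap_id[OF A])

lemma from_to_chart: "c \<in> A \<Longrightarrow> x \<in> cdom c \<Longrightarrow> from_chart A c x (to_chart A c x v) = v"
  using tmap_compose[OF A A id_smooth A id_smooth, of "chart_at A x" c "chart_at A x" x v]
  by (simp add: to_chart_tmap from_chart_tmap at_chart tmap_id[OF A])

lemma to_chart_at: "to_chart A (chart_at A x) x v = v"
  by (simp add: to_chart_tmap tmap_id[OF A] at_chart)

lemma from_chart_at: "from_chart A (chart_at A x) x v = v"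
  by (simp add: from_chart_tmap tmap_id[OF A] at_chart)

lemma vf_comp_cmap: "c \<in> A \<Longrightarrow> x \<in> cdom c \<Longrightarrow> vf_comp A c X (cmap c x) = to_chart A c x (X x)"
  by (simp add: vf_comp_def cinv_cmap chart)

lemma vector_fieldI: "(\<And>c. c \<in> A \<Longrightarrow> smooth_on (cran c) (vf_comp A c X)) \<Longrightarrow> vector_field A X"
  by (simp add: vector_field_def)

lemma vector_field_smooth: "vector_field A X \<Longrightarrow> c \<in> A \<Longrightarrow> smooth_on (cran c) (vf_comp A c X)"
  by (simp add: vector_field_def)

lemma vector_field_add:
  assumes "vector_field A X" "vector_field A Y"
  shows "vector_field A (\<lambda>x. X x + Y x)"
proof (rule vector_fieldI)
  fix c assume c: "c \<in> A"
  have "smooth_on (cran c) (\<lambda>u. vf_comp A c X u + vf_comp A c Y u)"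
    by (intro smooth_on_add ran_open c vector_field_smooth assms)
  then show "smooth_on (cran c) (vf_comp A c (\<lambda>x. X x + Y x))"
    by (rule smooth_on_cong[OF ran_open[OF c], rotated])
       (simp add: vf_comp_def linear_add[OF linear_to_chart[OF c]] cinv_in)
qed

lemma vector_field_zero: "vector_field A (\<lambda>x. 0)"
proof (rule vector_fieldI)
  fix c assume c: "c \<in> A"
  show "smooth_on (cran c) (vf_comp A c (\<lambda>x. 0))"
    by (rule smooth_on_cong[OF ran_open[OF c] _ smooth_on_const[of _ 0]])
       (simp add: vf_comp_def linear_0[OF linear_to_chart[OF c]] cinv_in)
qed

lemma vector_field_uminus:
  assumes "vector_field A X"
  shows "vector_field A (\<lambda>x. - X x)"
proof (rule vector_fieldI)
  fix c assume c: "c \<in> A"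
  have "smooth_on (cran c) (\<lambda>u. - vf_comp A c X u)"
    by (intro smooth_on_bounded_linear[OF bounded_linear_minus[OF bounded_linear_ident]]
        ran_open c vector_field_smooth assms)
  then show "smooth_on (cran c) (vf_comp A c (\<lambda>x. - X x))"
    by (rule smooth_on_cong[OF ran_open[OF c], rotated])
       (simp add: vf_comp_def linear_neg[OF linear_to_chart[OF c]] cinv_in)
qed

lemma vector_field_diff:
  "vector_field A X \<Longrightarrow> vector_field A Y \<Longrightarrow> vector_field A (\<lambda>x. X x - Y x)"
  using vector_field_add[of X "\<lambda>x. - Y x"] vector_field_uminus[of Y] by simp

lemma vector_field_endo:
  assumes T: "endo_field A T" and X: "vector_field A X"
  shows "vector_field A (\<lambda>x. T x (X x))"
proof (rule vector_fieldI)
  fix c assume c: "c \<in> A"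
  let ?T = "\<lambda>u v. to_chart A c (cinv c u) (T (cinv c u) (from_chart A c (cinv c u) v))"
  have "smooth_on (cran c) (\<lambda>u. ?T u (vf_comp A c X u))"
  proof (rule smooth_on_linear_apply[OF ran_open[OF c], where L="?T"])
    show "linear (?T u)" if u: "u \<in> cran c" for u
    proof -
      have "linear (T (cinv c u))" using T by (simp add: endo_field_def)
      then show ?thesis
        using linear_compose[OF linear_compose[OF linear_from_chart[OF c cinv_in[OF u]]]
            linear_to_chart[OF c cinv_in[OF u]], of "T (cinv c u)"]
        by (simp add: o_def)
    qed
  qed (use T X c in \<open>auto simp: endo_field_def vector_field_def\<close>)
  then show "smooth_on (cran c) (vf_comp A c (\<lambda>x. T x (X x)))"
    by (rule smooth_on_cong[OF ran_open[OF c], rotated]) (simp add: vf_comp_def from_to_chart[OF c] cinv_in)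
qed

text \<open>In a chart the metric is bilinear in the components with smooth coefficients;
  \<open>smooth_on_linear_apply\<close> is used once for each slot.\<close>

lemma smooth_fun_metric:
  assumes g: "riemannian_metric A g" and X: "vector_field A X" and Y: "vector_field A Y"
  shows "smooth_fun A (\<lambda>x. g x (X x) (Y x))"
  unfolding smooth_fun_def
proof
  fix c assume c: "c \<in> A"
  let ?G = "\<lambda>u a b. g (cinv c u) (from_chart A c (cinv c u) a) (from_chart A c (cinv c u) b)"
  have l1: "linear (\<lambda>a. ?G u a b)" and l2: "linear (?G u a)" if u: "u \<in> cran c" for u a b
  proof -
    have bil: "bilinear (g (cinv c u))" using g by (simp add: riemannian_metric_def)
    note l = linear_from_chart[OF c cinv_in[OF u]]
    show "linear (\<lambda>a. ?G u a b)" "linear (?G u a)"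
      using linear_compose[OF l, of "\<lambda>v. g (cinv c u) v (from_chart A c (cinv c u) b)"]
        linear_compose[OF l, of "\<lambda>v. g (cinv c u) (from_chart A c (cinv c u) a) v"] bil
      by (auto simp: o_def bilinear_def)
  qed
  have "smooth_on (cran c) (\<lambda>u. ?G u (vf_comp A c X u) (vf_comp A c Y u))"
  proof (rule smooth_on_linear_apply[OF ran_open[OF c] l2 _ vector_field_smooth[OF Y c]])
    fix e
    show "smooth_on (cran c) (\<lambda>u. ?G u (vf_comp A c X u) e)"
    proof (rule smooth_on_linear_apply[OF ran_open[OF c] l1 _ vector_field_smooth[OF X c]])
      show "smooth_on (cran c) (\<lambda>u. ?G u a e)" for a
        using g c unfolding riemannian_metric_def by blast
    qed auto
  qed auto
  then show "smooth_on (cran c) ((\<lambda>x. g x (X x) (Y x)) \<circ> cinv c)"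
    by (rule smooth_on_cong[OF ran_open[OF c], rotated]) (simp add: vf_comp_def from_to_chart[OF c] cinv_in)
qed

text \<open>
  Connections act on global vector fields only, so this is what allows nondegeneracy of the metric
  to be used pointwise.
\<close>

lemma exists_vector_field:
  obtains Z where "vector_field A Z" "Z x = v"
proof -
  define d where "d = chart_at A x"
  have d: "d \<in> A" "x \<in> cdom d" by (simp_all add: d_def at_chart)
  obtain r where r: "r > 0" "cball (cmap d x) r \<subseteq> cran d"
    using ran_open[OF d(1)] d(2) by (meson imageI open_contains_cball)
  obtain \<rho> :: "'e \<Rightarrow> real" where \<rho>: "smooth_on UNIV \<rho>" "\<rho> (cmap d x) = 1" "\<forall>z. z \<notin> cball (cmap d x) r \<longrightarrow> \<rho> z = 0"
    using bump_function[OF r(1), of "cmap d x"] by blast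
  \<comment> \<open>Constant components in one chart, cut off by the bump function before the edge
    of the chart so that the extension by 0 is smooth.\<close>
  define Z where "Z y = (if y \<in> cdom d then from_chart A d y (\<rho> (cmap d y) *\<^sub>R v) else 0)" for y
  define K where "K = cinv d ` cball (cmap d x) r"
  have "continuous_on (cran d) (cinv d)"
    using chart[OF d(1)] by (simp add: is_chart_def homeomorphism_def)
  then have "compact K" unfolding K_def
    using compact_continuous_image[OF continuous_on_subset[OF _ r(2)] compact_cball] by blast
  \<comment> \<open>Closedness in all of M uses that M is Hausdorff. So the complement of K is open
    and Z vanishes there; every point has a neighbourhood either inside the chart d or off
    K.\<close>
  then have K: "closed K" by (rule compact_imp_closed)
  have KD: "K \<subseteq> cdom d" unfolding K_def using r(2) cinv_in[of _ d] by (intro image_subsetI) blast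
  have Z0: "Z y = 0" if "y \<notin> K" for y
  proof (cases "y \<in> cdom d")
    case True
    have "cmap d y \<notin> cball (cmap d x) r"
      using that cinv_cmap[OF chart[OF d(1)] True] unfolding K_def by (metis imageI)
    then show ?thesis using True \<rho>(3) linear_0[OF linear_from_chart[OF d(1) True]] by (simp add: Z_def)
  qed (simp add: Z_def)
  have "vector_field A Z"
  proof (rule vector_fieldI)
    fix c assume c: "c \<in> A"
    show "smooth_on (cran c) (vf_comp A c Z)"
    proof (rule smooth_on_local[OF ran_open[OF c]])
      fix u assume u: "u \<in> cran c"
      show "\<exists>U. open U \<and> u \<in> U \<and> smooth_on U (vf_comp A c Z)"
      proof (cases "cinv c u \<in> K")
        case True
        let ?U = "cmap c ` (cdom c \<inter> id -` cdom d)" and ?V = "cmap d ` (cdom d \<inter> id -` cdom c)"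
        note U = open_loc_dom[OF A A id_smooth c d(1)] and V = open_loc_dom[OF A A id_smooth d(1) c]
        have uU: "u \<in> ?U"
          by (rule image_eqI[of _ _ "cinv c u"]) (use True KD cinv_in[OF u] cmap_cinv[OF u] in auto)
        have sub: "(cmap d \<circ> id \<circ> cinv c) ` ?U \<subseteq> ?V"
        proof (rule image_subsetI)
          fix w assume "w \<in> ?U"
          note w = loc_dom_simps[OF A A id_smooth c this]
          then show "(cmap d \<circ> id \<circ> cinv c) w \<in> ?V" by auto
        qed
        note s1 = smooth_loc_rep[OF A A id_smooth c d(1)]
        have "smooth_on ?V (\<lambda>z. \<rho> z *\<^sub>R frechet_derivative (cmap c \<circ> id \<circ> cinv d) (at z) v)"
          by (intro smooth_on_scaleR[OF V] smooth_on_frechet_derivative smooth_on_subset[OF \<rho>(1)]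
              smooth_loc_rep[OF A A id_smooth d(1) c]) auto
        from smooth_on_compose[OF U V sub this s1]
        have "smooth_on ?U (vf_comp A c Z)"
        proof (rule smooth_on_cong[OF U, rotated])
          fix w assume "w \<in> ?U"
          note w = loc_dom_simps[OF A A id_smooth c this]
          show "\<rho> ((cmap d \<circ> id \<circ> cinv c) w) *\<^sub>R
              frechet_derivative (cmap c \<circ> id \<circ> cinv d) (at ((cmap d \<circ> id \<circ> cinv c) w)) v = vf_comp A c Z w"
            using w linear_scale[OF linear_tmap[OF A A id_smooth d(1) c, of "cinv c w"]]
            by (simp add: vf_comp_def Z_def to_from_chart_tmap c d) (simp add: tmap_def)
        qed
        then show ?thesis using U uU by blast
      next
        case False
        let ?U = "cmap c ` (cdom c \<inter> - K)"
        have U: "open ?U" by (rule open_chart_image[OF chart[OF c]]) (use K in auto)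
        have "smooth_on ?U (vf_comp A c Z)"
        proof (rule smooth_on_cong[OF U _ smooth_on_const[of _ 0]])
          fix w assume "w \<in> ?U"
          then obtain y where y: "y \<in> cdom c" "y \<notin> K" "w = cmap c y" by auto
          then show "0 = vf_comp A c Z w"
            using linear_0[OF linear_to_chart[OF c y(1)]] by (simp add: vf_comp_cmap c Z0)
        qed
        moreover have "u \<in> ?U" by (rule image_eqI[of _ _ "cinv c u"]) (use False cinv_in[OF u] cmap_cinv[OF u] in auto)
        ultimately show ?thesis using U by blast
      qed
    qed
  qed
  moreover have "Z x = v" using d \<rho>(2) by (simp add: Z_def) (simp add: d_def from_chart_at)
  ultimately show ?thesis using that by blast
qed

end

section \<open>Smooth maps between manifolds and related vector fields\<close>

locale smooth_map_between = M: smooth_manifold A + N: smooth_manifold B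
  for A :: "('m::{t2_space,second_countable_topology}, 'e::euclidean_space) chart set"
    and B :: "('n::{t2_space,second_countable_topology}, 'f::euclidean_space) chart set" +
  fixes p :: "'m \<Rightarrow> 'n"
  assumes p: "smooth_map A B p"
begin

abbreviation dp :: "'m \<Rightarrow> 'e \<Rightarrow> 'f" where "dp \<equiv> differential A B p"

lemma linear_dp: "linear (dp x)"
  unfolding differential_tmap by (rule linear_tmap[OF M.A N.A p]) (auto simp: M.at_chart N.at_chart)

text \<open>Both sides are the tangent map from the preferred chart at x to d, factored once through
  the chart c of M and once through the preferred chart at p x.\<close>

lemma tmap_to_chart:
  assumes "c \<in> A" "d \<in> B" "x \<in> cdom c" "p x \<in> cdom d"
  shows "tmap c d p x (to_chart A c x v) = to_chart B d (p x) (dp x v)"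
  using tmap_compose[OF M.A M.A M.id_smooth N.A p, of "chart_at A x" c d x v]
    tmap_compose[OF M.A N.A p N.A N.id_smooth, of "chart_at A x" "chart_at B (p x)" d x v] assms
  by (simp add: to_chart_tmap differential_tmap M.at_chart N.at_chart)

lemma vf_apply_comp:
  assumes f: "smooth_fun B f" and X: "dp x (X x) = X' (p x)"
  shows "vf_apply A X (\<lambda>y. f (p y)) x = vf_apply B X' f (p x)"
proof -
  let ?c = "chart_at A x" and ?d = "chart_at B (p x)"
  have "smooth_on (cran ?d) (f \<circ> cinv ?d)" using f N.at_chart by (simp add: smooth_fun_def)
  then have f': "((f \<circ> cinv ?d) has_derivative frechet_derivative (f \<circ> cinv ?d) (at (cmap ?d (p x)))) (at (cmap ?d (p x)))"
    by (rule smooth_on_has_derivative) (simp add: N.at_chart)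
  have e: "(cmap ?d \<circ> p \<circ> cinv ?c) (cmap ?c x) = cmap ?d (p x)"
    by (simp add: cinv_cmap M.chart M.at_chart)
  have "((cmap ?d \<circ> p \<circ> cinv ?c) has_derivative dp x) (at (cmap ?c x))"
    unfolding differential_tmap by (rule tmap_has_derivative[OF M.A N.A p]) (auto simp: M.at_chart N.at_chart)
  from diff_chain_at[OF this f'[folded e]]
  have "((f \<circ> cinv ?d) \<circ> (cmap ?d \<circ> p \<circ> cinv ?c) has_derivative
      frechet_derivative (f \<circ> cinv ?d) (at (cmap ?d (p x))) \<circ> dp x) (at (cmap ?c x))"
    unfolding e .
  then have "(((\<lambda>y. f (p y)) \<circ> cinv ?c) has_derivative
      frechet_derivative (f \<circ> cinv ?d) (at (cmap ?d (p x))) \<circ> dp x) (at (cmap ?c x))"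
  proof (rule has_derivative_transform_within_open[OF _ open_loc_dom[OF M.A N.A p M.at_chart(1) N.at_chart(1)]])
    show "cmap ?c x \<in> cmap ?c ` (cdom ?c \<inter> p -` cdom ?d)" by (auto simp: M.at_chart N.at_chart)
    fix u assume "u \<in> cmap ?c ` (cdom ?c \<inter> p -` cdom ?d)"
    note u = loc_dom_simps[OF M.A N.A p M.at_chart(1) this]
    show "((f \<circ> cinv ?d) \<circ> (cmap ?d \<circ> p \<circ> cinv ?c)) u = ((\<lambda>y. f (p y)) \<circ> cinv ?c) u"
      using cinv_cmap[OF N.chart[OF N.at_chart(1)] u(3)] by simp
  qed
  from frechet_derivative_at[OF this] show ?thesis unfolding vf_apply_def by (metis X comp_apply)
qed

text \<open>In charts with p represented by P, relatedness reads Z'(P w) = DP(w) Z(w).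
  Differentiating in a direction a gives the image of DZ a plus the second derivative of P on Z and
  a. In the bracket the two second-derivative terms are symmetric and cancel.\<close>

lemma lie_bracket_related:
  assumes X: "vector_field A X" and Y: "vector_field A Y"
    and X': "vector_field B X'" and Y': "vector_field B Y'"
    and rX: "\<And>x. dp x (X x) = X' (p x)" and rY: "\<And>x. dp x (Y x) = Y' (p x)"
  shows "dp x (lie_bracket A X Y x) = lie_bracket B X' Y' (p x)"
proof -
  define c where "c = chart_at A x"
  define d where "d = chart_at B (p x)"
  have c: "c \<in> A" "x \<in> cdom c" and d: "d \<in> B" "p x \<in> cdom d"
    by (auto simp: c_def d_def M.at_chart N.at_chart)
  define P where "P = cmap d \<circ> p \<circ> cinv c"
  define U where "U = cmap c ` (cdom c \<inter> p -` cdom d)"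
  define u where "u = cmap c x"
  have U: "open U" "u \<in> U" unfolding U_def u_def
    using open_loc_dom[OF M.A N.A p c(1) d(1)] c d by auto
  have sP: "smooth_on U P" unfolding U_def P_def by (rule smooth_loc_rep[OF M.A N.A p c(1) d(1)])
  have dP: "frechet_derivative P (at u) = dp x"
    unfolding differential_tmap tmap_def P_def u_def c_def d_def ..
  have Pu: "P u = cmap d (p x)" by (simp add: P_def u_def cinv_cmap[OF M.chart] c)
  have lin: "linear (frechet_derivative P (at w))" if "w \<in> U" for w
    using linear_frechet_derivative smooth_on_differentiable[OF sP that] by blast
  have D: "frechet_derivative (vf_comp B d Z') (at (cmap d (p x))) (dp x a) =
      dp x (frechet_derivative (vf_comp A c Z) (at u) a) +
      frechet_derivative (\<lambda>w. frechet_derivative P (at w) (Z x)) (at u) a"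
    if Z: "vector_field A Z" "vector_field B Z'" and r: "\<And>x. dp x (Z x) = Z' (p x)" for Z Z' a
  proof -
    have 1: "(vf_comp B d Z' \<circ> P) w = frechet_derivative P (at w) (vf_comp A c Z w)" if "w \<in> U" for w
    proof -
      note w = loc_dom_simps[OF M.A N.A p c(1) that[unfolded U_def]]
      have "(vf_comp B d Z' \<circ> P) w = to_chart B d (p (cinv c w)) (dp (cinv c w) (Z (cinv c w)))"
        using N.vf_comp_cmap[OF d(1) w(3)] by (simp add: P_def r)
      also have "\<dots> = tmap c d p (cinv c w) (vf_comp A c Z w)"
        using tmap_to_chart[OF c(1) d(1) w(2,3)] by (simp add: vf_comp_def)
      finally show ?thesis by (simp add: tmap_def w(4) P_def)
    qed
    have "smooth_on (cran d) (vf_comp B d Z')" by (rule N.vector_field_smooth[OF Z(2) d(1)])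
    then have "(vf_comp B d Z' has_derivative frechet_derivative (vf_comp B d Z') (at (P u))) (at (P u))"
      by (rule smooth_on_has_derivative) (simp add: Pu d)
    from diff_chain_at[OF smooth_on_has_derivative[OF sP U(2)] this]
    have 2: "((\<lambda>w. frechet_derivative P (at w) (vf_comp A c Z w)) has_derivative
      frechet_derivative (vf_comp B d Z') (at (P u)) \<circ> frechet_derivative P (at u)) (at u)"
      by (rule has_derivative_transform_within_open[OF _ U]) (rule 1)
    have "u \<in> cran c" using c by (simp add: u_def)
    then have "vf_comp A c Z differentiable (at u)"
      using smooth_on_differentiable M.vector_field_smooth[OF Z(1) c(1)] by blast
    from has_derivative_unique[OF 2 has_derivative_linear_apply[OF U(1) lin smooth_on_frechet_derivative[OF sP] U(2) this]]
    have "frechet_derivative (vf_comp B d Z') (at (P u)) (dp x a) =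
      dp x (frechet_derivative (vf_comp A c Z) (at u) a) +
      frechet_derivative (\<lambda>w. frechet_derivative P (at w) (vf_comp A c Z u)) (at u) a"
      unfolding dP by (metis comp_apply)
    \<comment> \<open>Here c is the preferred chart at x, in which a tangent vector at x is its own
      component vector.\<close>
    moreover have "vf_comp A c Z u = Z x"
      using M.vf_comp_cmap[OF c, of Z] by (simp add: u_def) (simp add: c_def M.to_chart_at)
    ultimately show ?thesis by (simp add: Pu)
  qed
  have "lie_bracket B X' Y' (p x) = frechet_derivative (vf_comp B d Y') (at (cmap d (p x))) (dp x (X x)) -
      frechet_derivative (vf_comp B d X') (at (cmap d (p x))) (dp x (Y x))"
    by (simp add: lie_bracket_def Let_def d_def rX rY)
  also have "\<dots> = dp x (frechet_derivative (vf_comp A c Y) (at u) (X x)) -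
      dp x (frechet_derivative (vf_comp A c X) (at u) (Y x))"
    unfolding D[OF X X' rX] D[OF Y Y' rY]
    using symmetric_second_derivative[OF U sP, of "X x" "Y x"] by simp
  also have "\<dots> = dp x (lie_bracket A X Y x)"
    by (simp add: lie_bracket_def Let_def c_def u_def linear_diff[OF linear_dp])
  finally show ?thesis by simp
qed

end


section \<open>Riemannian submersions\<close>

locale riemannian_manifold = smooth_manifold A
  for A :: "('m::{t2_space,second_countable_topology}, 'e::euclidean_space) chart set" +
  fixes g :: "'m \<Rightarrow> 'e \<Rightarrow> 'e \<Rightarrow> real" and D :: "('m \<Rightarrow> 'e) \<Rightarrow> ('m \<Rightarrow> 'e) \<Rightarrow> ('m \<Rightarrow> 'e)"
  assumes g: "riemannian_metric A g" and D: "levi_civita A g D"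
begin

lemma bilinear_g: "bilinear (g x)"
  and g_sym: "g x u v = g x v u"
  and g_pos: "v \<noteq> 0 \<Longrightarrow> g x v v > 0"
  using g by (simp_all add: riemannian_metric_def)

lemmas g_simps = bilinear_ladd[OF bilinear_g] bilinear_radd[OF bilinear_g]
  bilinear_lsub[OF bilinear_g] bilinear_rsub[OF bilinear_g]
  bilinear_lneg[OF bilinear_g] bilinear_rneg[OF bilinear_g]
  bilinear_lzero[OF bilinear_g] bilinear_rzero[OF bilinear_g]
  bilinear_lmul[OF bilinear_g] bilinear_rmul[OF bilinear_g]

lemma g_self_eq_0: "g x v v = 0 \<Longrightarrow> v = 0"
  using g_pos[of v x] by (cases "v = 0") auto

lemmas connection = D[unfolded levi_civita_def affine_connection_def, THEN conjunct1]

lemma D_vf: "vector_field A X \<Longrightarrow> vector_field A Y \<Longrightarrow> vector_field A (D X Y)"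
  by (rule connection[THEN conjunct1, rule_format])

lemma D_add_left: "vector_field A X \<Longrightarrow> vector_field A X' \<Longrightarrow> vector_field A Y \<Longrightarrow>
    D (\<lambda>x. X x + X' x) Y = (\<lambda>x. D X Y x + D X' Y x)"
  by (rule connection[THEN conjunct2, THEN conjunct1, rule_format])

lemma D_add_right: "vector_field A X \<Longrightarrow> vector_field A Y \<Longrightarrow> vector_field A Y' \<Longrightarrow>
    D X (\<lambda>x. Y x + Y' x) = (\<lambda>x. D X Y x + D X Y' x)"
  by (rule connection[THEN conjunct2, THEN conjunct2, THEN conjunct2, THEN conjunct1, rule_format])

lemma lie_bracket_eq: "vector_field A X \<Longrightarrow> vector_field A Y \<Longrightarrow>
    lie_bracket A X Y = (\<lambda>x. D X Y x - D Y X x)"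
  using D unfolding levi_civita_def by (simp add: fun_eq_iff)

lemma vf_apply_metric: "vector_field A X \<Longrightarrow> vector_field A Y \<Longrightarrow> vector_field A Z \<Longrightarrow>
    vf_apply A X (\<lambda>y. g y (Y y) (Z y)) x = g x (D X Y x) (Z x) + g x (Y x) (D X Z x)"
  using D unfolding levi_civita_def by simp

lemma vector_field_lie_bracket: "vector_field A X \<Longrightarrow> vector_field A Y \<Longrightarrow> vector_field A (lie_bracket A X Y)"
  by (simp add: lie_bracket_eq vector_field_diff D_vf)

lemma D_zero_left: "vector_field A Y \<Longrightarrow> D (\<lambda>x. 0) Y = (\<lambda>x. 0)"
  using D_add_left[OF vector_field_zero vector_field_zero, of Y] by (simp add: fun_eq_iff)

lemma D_zero_right: "vector_field A X \<Longrightarrow> D X (\<lambda>x. 0) = (\<lambda>x. 0)"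
  using D_add_right[OF _ vector_field_zero vector_field_zero, of X] by (simp add: fun_eq_iff)

lemma D_uminus_right: "vector_field A X \<Longrightarrow> vector_field A Y \<Longrightarrow> D X (\<lambda>x. - Y x) = (\<lambda>x. - D X Y x)"
  using D_add_right[of X Y "\<lambda>x. - Y x"] D_zero_right[of X]
  by (simp add: vector_field_uminus fun_eq_iff eq_neg_iff_add_eq_0 add.commute)

lemma lie_bracket_zero: "vector_field A X \<Longrightarrow> lie_bracket A (\<lambda>x. 0) X = (\<lambda>x. 0)"
  by (simp add: lie_bracket_eq vector_field_zero D_zero_left D_zero_right)

text \<open>The right-hand side involves only the metric and Lie brackets, and for horizontal lifts
  both descend to N; this is how the two connections are compared.\<close>

lemma koszul:
  assumes X: "vector_field A X" and Y: "vector_field A Y" and Z: "vector_field A Z"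
  shows "2 * g x (D X Y x) (Z x) =
    vf_apply A X (\<lambda>y. g y (Y y) (Z y)) x + vf_apply A Y (\<lambda>y. g y (X y) (Z y)) x
    - vf_apply A Z (\<lambda>y. g y (X y) (Y y)) x + g x (lie_bracket A X Y x) (Z x)
    - g x (lie_bracket A X Z x) (Y x) - g x (lie_bracket A Y Z x) (X x)"
  unfolding vf_apply_metric[OF X Y Z] vf_apply_metric[OF Y X Z] vf_apply_metric[OF Z X Y]
    lie_bracket_eq[OF X Y] lie_bracket_eq[OF X Z] lie_bracket_eq[OF Y Z]
  by (simp add: g_simps g_sym[of x "Y x"] g_sym[of x "X x"])

end

section \<open>Horizontal vectors and the linear system for lifts\<close>

locale riemannian_submersion_between = smooth_map_between A B p +
    M: riemannian_manifold A g D + N: riemannian_manifold B g' D'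
  for A :: "('m::{t2_space,second_countable_topology}, 'e::euclidean_space) chart set"
    and B :: "('n::{t2_space,second_countable_topology}, 'f::euclidean_space) chart set"
    and p :: "'m \<Rightarrow> 'n"
    and g :: "'m \<Rightarrow> 'e \<Rightarrow> 'e \<Rightarrow> real" and D :: "('m \<Rightarrow> 'e) \<Rightarrow> ('m \<Rightarrow> 'e) \<Rightarrow> ('m \<Rightarrow> 'e)"
    and g' :: "'n \<Rightarrow> 'f \<Rightarrow> 'f \<Rightarrow> real" and D' :: "('n \<Rightarrow> 'f) \<Rightarrow> ('n \<Rightarrow> 'f) \<Rightarrow> ('n \<Rightarrow> 'f)" +
  assumes sub: "riemannian_submersion A B g g' p"
begin

abbreviation "hor \<equiv> horizontal A B g p"
abbreviation "ver \<equiv> vertical A B p"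

lemma surj_dp: "surj (dp x)"
  using sub by (simp add: riemannian_submersion_def)

lemma dp_isometry: "u \<in> hor x \<Longrightarrow> v \<in> hor x \<Longrightarrow> g' (p x) (dp x u) (dp x v) = g x u v"
  using sub unfolding riemannian_submersion_def by blast

lemma dp_simps:
  "dp x 0 = 0" "dp x (u + v) = dp x u + dp x v" "dp x (u - v) = dp x u - dp x v" "dp x (- u) = - dp x u"
  by (simp_all add: linear_0 linear_add linear_diff linear_neg linear_dp)

lemma ver_iff: "v \<in> ver x \<longleftrightarrow> dp x v = 0"
  by (simp add: vertical_def)

lemma hor_orth: "u \<in> hor x \<Longrightarrow> dp x v = 0 \<Longrightarrow> g x u v = 0"
  by (simp add: horizontal_def ver_iff)

lemma hor_diff: "u \<in> hor x \<Longrightarrow> v \<in> hor x \<Longrightarrow> u - v \<in> hor x"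
  by (simp add: horizontal_def M.g_simps)

lemma hor_inj:
  assumes "u \<in> hor x" "v \<in> hor x" "dp x u = dp x v"
  shows "u = v"
  using M.g_self_eq_0[of x "u - v"] hor_orth[OF hor_diff[OF assms(1,2)], of "u - v"] assms(3)
  by (simp add: dp_simps)

text \<open>
  In local coordinates the horizontal lift of a vector \<open>y\<close> is the \<open>w\<close>-component of the solution of
  the nonsingular system \<open>P w = y\<close>, \<open>G w e = \<langle>P e, \<lambda>\<rangle>\<close> for all \<open>e\<close>, where \<open>P\<close> represents the
  differential, \<open>G\<close> the metric, and the unknown \<open>\<lambda>\<close> is a Lagrange multiplier.
\<close>

definition saddle :: "('m, 'e) chart \<Rightarrow> ('n, 'f) chart \<Rightarrow> 'e \<Rightarrow> 'f \<times> 'e \<Rightarrow> 'f \<times> 'e" where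
  "saddle c d u z = (frechet_derivative (cmap d \<circ> p \<circ> cinv c) (at u) (snd z),
     (\<Sum>e\<in>Basis. (g (cinv c u) (from_chart A c (cinv c u) (snd z)) (from_chart A c (cinv c u) e)
        - frechet_derivative (cmap d \<circ> p \<circ> cinv c) (at u) e \<bullet> fst z) *\<^sub>R e))"

text \<open>The second component of the system collects the values of a linear form on the basis.
  Its vanishing extends by linearity to every tangent vector v.\<close>

lemma saddle_solution:
  assumes c: "c \<in> A" and d: "d \<in> B" and u: "u \<in> cmap c ` (cdom c \<inter> p -` cdom d)"
    and sol: "saddle c d u (l, w) = (y, 0)"
  shows "frechet_derivative (cmap d \<circ> p \<circ> cinv c) (at u) w = y"
    "g (cinv c u) (from_chart A c (cinv c u) w) v = to_chart B d (p (cinv c u)) (dp (cinv c u) v) \<bullet> l"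
proof -
  let ?P = "frechet_derivative (cmap d \<circ> p \<circ> cinv c) (at u)" and ?x = "cinv c u"
  note x = loc_dom_simps[OF M.A N.A p c u]
  have P: "?P = tmap c d p ?x" by (simp add: tmap_def x(4))
  have lP: "linear ?P" unfolding P by (rule linear_tmap[OF M.A N.A p c d x(2,3)])
  let ?f = "\<lambda>e. g ?x (from_chart A c ?x w) (from_chart A c ?x e) - ?P e \<bullet> l"
  have "linear (\<lambda>e. g ?x (from_chart A c ?x w) (from_chart A c ?x e))"
    using linear_compose[OF M.linear_from_chart[OF c x(2)], of "g ?x (from_chart A c ?x w)"] M.bilinear_g
    by (auto simp: bilinear_def o_def)
  moreover have "linear (\<lambda>e. ?P e \<bullet> l)"
    using linear_compose[OF lP bounded_linear.linear[OF bounded_linear_inner_left]] by (simp add: o_def)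
  ultimately have lf: "linear ?f" by (rule linear_compose_sub)
  have s: "?P w = y" "(\<Sum>e\<in>Basis. ?f e *\<^sub>R e) = 0" using sol by (simp_all add: saddle_def)
  show "?P w = y" by (rule s(1))
  have "?f e = 0" if "e \<in> Basis" for e
  proof -
    have "(\<Sum>e\<in>Basis. ?f e *\<^sub>R e) \<bullet> e = ?f e"
      using that by (simp add: inner_sum_left inner_Basis if_distrib cong: if_cong)
    then show ?thesis using s(2) by simp
  qed
  then have f0: "?f e = 0" for e using linear_basis_sum[OF lf, of e] by simp
  have "?P (to_chart A c ?x v) = to_chart B d (p ?x) (dp ?x v)"
    unfolding P by (rule tmap_to_chart[OF c d x(2,3)])
  then show "g ?x (from_chart A c ?x w) v = to_chart B d (p ?x) (dp ?x v) \<bullet> l"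
    using f0[of "to_chart A c ?x v"] by (simp add: M.from_to_chart[OF c x(2)])
qed

lemma linear_saddle:
  assumes c: "c \<in> A" and d: "d \<in> B" and u: "u \<in> cmap c ` (cdom c \<inter> p -` cdom d)"
  shows "linear (saddle c d u)"
proof -
  note x = loc_dom_simps[OF M.A N.A p c u]
  have lP: "linear (frechet_derivative (cmap d \<circ> p \<circ> cinv c) (at u))"
    using linear_tmap[OF M.A N.A p c d x(2,3)] by (simp add: tmap_def x(4))
  note lF = M.linear_from_chart[OF c x(2)]
  show ?thesis
    by (rule linearI)
       (simp_all add: saddle_def linear_add[OF lP] linear_add[OF lF] linear_scale[OF lP] linear_scale[OF lF]
         M.g_simps inner_add_right scaleR_sum_right sum.distrib[symmetric] algebra_simps)
qed

text \<open>For zero data w is vertical, and testing the multiplier equation with w itself gives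
  g(w, w) = 0. The equation then says that l is orthogonal to the image of the differential, which
  is everything.\<close>

lemma saddle_inj:
  assumes c: "c \<in> A" and d: "d \<in> B" and u: "u \<in> cmap c ` (cdom c \<inter> p -` cdom d)"
    and 0: "saddle c d u z = 0"
  shows "z = 0"
proof -
  obtain l w where z: "z = (l, w)" by force
  let ?x = "cinv c u"
  note x = loc_dom_simps[OF M.A N.A p c u]
  have "saddle c d u (l, w) = (0, 0)" using 0 unfolding z zero_prod_def .
  note s = saddle_solution[OF c d u this]
  have dp_w: "to_chart B d (p ?x) (dp ?x (from_chart A c ?x w)) = 0"
    using tmap_to_chart[OF c d x(2,3), of "from_chart A c ?x w"] s(1)
    by (simp add: M.to_from_chart[OF c x(2)] tmap_def x(4))
  then have "from_chart A c ?x w = 0"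
    using s(2)[of "from_chart A c ?x w"] M.g_self_eq_0 by simp
  note w0 = this
  then have w: "w = 0"
    using M.to_from_chart[OF c x(2), of w] linear_0[OF M.linear_to_chart[OF c x(2)]] by simp
  obtain v where "dp ?x v = from_chart B d (p ?x) l" using surj_dp by (metis surjD)
  with s(2)[of v] have "l \<bullet> l = 0"
    by (simp add: w0 M.g_simps N.to_from_chart[OF d x(3)])
  with w z show ?thesis by (simp add: zero_prod_def)
qed

text \<open>On vertical v the multiplier term vanishes, so w is orthogonal to the vertical space;
  the first component prescribes its image.\<close>

lemma saddle_lift:
  assumes c: "c \<in> A" and d: "d \<in> B" and u: "u \<in> cmap c ` (cdom c \<inter> p -` cdom d)"
    and sol: "saddle c d u (l, w) = (to_chart B d (p (cinv c u)) y, 0)"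
  shows "from_chart A c (cinv c u) w \<in> hor (cinv c u)" "dp (cinv c u) (from_chart A c (cinv c u) w) = y"
proof -
  let ?x = "cinv c u"
  note x = loc_dom_simps[OF M.A N.A p c u]
  note s = saddle_solution[OF c d u sol]
  show "from_chart A c ?x w \<in> hor ?x"
    using linear_0[OF N.linear_to_chart[OF d x(3)]] by (auto simp: horizontal_def ver_iff s(2))
  have "to_chart B d (p ?x) (dp ?x (from_chart A c ?x w)) = to_chart B d (p ?x) y"
    using tmap_to_chart[OF c d x(2,3), of "from_chart A c ?x w"] s(1)
    by (simp add: M.to_from_chart[OF c x(2)] tmap_def x(4))
  then show "dp ?x (from_chart A c ?x w) = y"
    using N.from_to_chart[OF d x(3)] by metis
qed

text \<open>The multiplier makes the system square: an injective endomorphism of a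
  finite-dimensional space is onto.\<close>

lemma saddle_surj:
  assumes "c \<in> A" "d \<in> B" "u \<in> cmap c ` (cdom c \<inter> p -` cdom d)"
  obtains l w where "saddle c d u (l, w) = y"
proof -
  have "inj (saddle c d u)"
    using linear_saddle[OF assms] saddle_inj[OF assms] by (simp add: linear_injective_0)
  then have "surj (saddle c d u)"
    using linear_saddle[OF assms] linear_injective_imp_surjective by blast
  then show ?thesis using that by (metis surjD surj_pair)
qed

section \<open>Horizontal lifts of vectors and vector fields\<close>

definition hlift :: "'m \<Rightarrow> 'f \<Rightarrow> 'e" where
  "hlift x y = (THE w. w \<in> hor x \<and> dp x w = y)"

text \<open>Existence is the solvability of the saddle system in the preferred charts; uniqueness
  holds because a vector both horizontal and vertical is orthogonal to itself.\<close>

lemma hlift: "hlift x y \<in> hor x" "dp x (hlift x y) = y"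
proof -
  let ?c = "chart_at A x" and ?d = "chart_at B (p x)"
  have u: "cmap ?c x \<in> cmap ?c ` (cdom ?c \<inter> p -` cdom ?d)" by (auto simp: M.at_chart N.at_chart)
  have e: "cinv ?c (cmap ?c x) = x" by (simp add: cinv_cmap M.chart M.at_chart)
  obtain l w where "saddle ?c ?d (cmap ?c x) (l, w) = (to_chart B ?d (p x) y, 0)"
    using saddle_surj[OF M.at_chart(1) N.at_chart(1) u] by blast
  from saddle_lift[OF M.at_chart(1) N.at_chart(1) u, unfolded e, OF this]
  have "\<exists>!w. w \<in> hor x \<and> dp x w = y" using hor_inj by blast
  from theI'[OF this] show "hlift x y \<in> hor x" "dp x (hlift x y) = y" by (auto simp: hlift_def)
qed

lemma hlift_eqI: "w \<in> hor x \<Longrightarrow> dp x w = y \<Longrightarrow> hlift x y = w"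
  using hlift hor_inj by blast

definition lift :: "('n \<Rightarrow> 'f) \<Rightarrow> 'm \<Rightarrow> 'e" where
  "lift X x = hlift x (X (p x))"

lemma lift_hor: "lift X x \<in> hor x" and dp_lift: "dp x (lift X x) = X (p x)"
  by (simp_all add: lift_def hlift)

lemma vector_field_lift:
  assumes X: "vector_field B X"
  shows "vector_field A (lift X)"
proof (rule M.vector_fieldI)
  fix c assume c: "c \<in> A"
  show "smooth_on (cran c) (vf_comp A c (lift X))"
  proof (rule smooth_on_local[OF M.ran_open[OF c]])
    fix u0 assume u0: "u0 \<in> cran c"
    define d where "d = chart_at B (p (cinv c u0))"
    have d: "d \<in> B" "p (cinv c u0) \<in> cdom d" by (auto simp: d_def N.at_chart)
    let ?U = "cmap c ` (cdom c \<inter> p -` cdom d)" and ?P = "cmap d \<circ> p \<circ> cinv c"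
    note U = open_loc_dom[OF M.A N.A p c d(1)] and sP = smooth_loc_rep[OF M.A N.A p c d(1)]
    have u0U: "u0 \<in> ?U"
      by (rule image_eqI[of _ _ "cinv c u0"]) (use d cinv_in[OF u0] cmap_cinv[OF u0] in auto)
    define b where "b u = (vf_comp B d X (?P u), 0 :: 'e)" for u
    have "?P ` ?U \<subseteq> cran d"
    proof (rule image_subsetI)
      fix u assume "u \<in> ?U"
      then show "?P u \<in> cran d" using loc_dom_simps[OF M.A N.A p c] by auto
    qed
    from smooth_on_compose[OF U N.ran_open[OF d(1)] this N.vector_field_smooth[OF X d(1)] sP]
    have sb: "smooth_on ?U b" unfolding b_def by (intro smooth_on_Pair[OF U]) auto
    have "\<exists>z. saddle c d u z = b u" if "u \<in> ?U" for u
      using saddle_surj[OF c d(1) that] by blast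
    \<comment> \<open>The solutions are picked point by point with no regularity;
      \<open>smooth_on_solve\<close> then yields smoothness from the equation alone.\<close>
    then obtain z where z: "\<And>u. u \<in> ?U \<Longrightarrow> saddle c d u (z u) = b u" by metis
    have s: "smooth_on ?U (\<lambda>u. saddle c d u a)" for a
      unfolding saddle_def
    proof (intro smooth_on_Pair[OF U] smooth_on_sum[OF U] smooth_on_scaleR[OF U] smooth_on_diff[OF U]
        smooth_on_inner[OF U] smooth_on_frechet_derivative sP smooth_on_const)
      show "smooth_on ?U (\<lambda>u. g (cinv c u) (from_chart A c (cinv c u) (snd a)) (from_chart A c (cinv c u) e))" for e
        by (rule smooth_on_subset[of "cran c"]) (use M.g c in \<open>auto simp: riemannian_metric_def\<close>)
    qed
    have "smooth_on ?U z"
      by (rule smooth_on_solve[OF U linear_saddle[OF c d(1)] saddle_inj[OF c d(1)] s z sb])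
    then have "smooth_on ?U (\<lambda>u. snd (z u))"
      by (rule smooth_on_bounded_linear[OF bounded_linear_snd U])
    then have "smooth_on ?U (vf_comp A c (lift X))"
    proof (rule smooth_on_cong[OF U, rotated])
      fix u assume u: "u \<in> ?U"
      note x = loc_dom_simps[OF M.A N.A p c u]
      have "b u = (to_chart B d (p (cinv c u)) (X (p (cinv c u))), 0)"
        unfolding b_def using N.vf_comp_cmap[OF d(1) x(3)] by simp
      then have "saddle c d u (fst (z u), snd (z u)) = (to_chart B d (p (cinv c u)) (X (p (cinv c u))), 0)"
        using z[OF u] by simp
      from saddle_lift[OF c d(1) u this]
      have "lift X (cinv c u) = from_chart A c (cinv c u) (snd (z u))"
        unfolding lift_def by (rule hlift_eqI)
      then show "snd (z u) = vf_comp A c (lift X) u"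
        by (simp add: vf_comp_def M.to_from_chart[OF c x(2)])
    qed
    with U u0U show "\<exists>U. open U \<and> u0 \<in> U \<and> smooth_on U (vf_comp A c (lift X))" by blast
  qed
qed

lemma horizontal_field_lift: "vector_field B X \<Longrightarrow> horizontal_field A B g p (lift X)"
  by (simp add: horizontal_field_def vector_field_lift lift_hor)

lemma vproj_eq: "vproj A B g p X x = X x - hlift x (dp x (X x))"
  unfolding vproj_def
proof (rule the_equality)
  show "X x - hlift x (dp x (X x)) \<in> ver x \<and> X x - (X x - hlift x (dp x (X x))) \<in> hor x"
    by (simp add: ver_iff dp_simps hlift)
  fix u assume u: "u \<in> ver x \<and> X x - u \<in> hor x"
  then have "hlift x (dp x (X x)) = X x - u" by (intro hlift_eqI) (auto simp: ver_iff dp_simps)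
  then show "u = X x - hlift x (dp x (X x))" by simp
qed

lemma hproj_eq: "hproj A B g p X x = hlift x (dp x (X x))"
  unfolding hproj_def
proof (rule the_equality)
  show "hlift x (dp x (X x)) \<in> hor x \<and> X x - hlift x (dp x (X x)) \<in> ver x"
    by (simp add: ver_iff dp_simps hlift)
  fix u assume u: "u \<in> hor x \<and> X x - u \<in> ver x"
  then show "u = hlift x (dp x (X x))" by (intro hlift_eqI[symmetric]) (auto simp: ver_iff dp_simps)
qed

text \<open>The vertical part of v is orthogonal to u, so v may be replaced by its horizontal part
  before the isometry property is applied.\<close>

lemma g_hor_left: "u \<in> hor x \<Longrightarrow> g x u v = g' (p x) (dp x u) (dp x v)"
  using hor_orth[of u x "v - hlift x (dp x v)"] dp_isometry[of u x "hlift x (dp x v)"]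
  by (simp add: hlift dp_simps M.g_simps)

lemma g_hor_right: "u \<in> hor x \<Longrightarrow> g x v u = g' (p x) (dp x v) (dp x u)"
  using g_hor_left[of u x v] by (simp add: M.g_sym[of x v] N.g_sym[of "p x" "dp x v"])

text \<open>Orthogonal decomposition of both arguments, with the horizontal contribution measured on
  N.\<close>

lemma g_split: "g x u v = g' (p x) (dp x u) (dp x v) + g x (u - hlift x (dp x u)) (v - hlift x (dp x v))"
  by (simp add: M.g_simps g_hor_left hlift g_hor_right)

lemma hlift_0: "hlift x 0 = 0"
  by (rule hlift_eqI) (auto simp: horizontal_def M.g_simps dp_simps)

section \<open>Covariant derivatives and curvature of lifted fields\<close>

lemma lift_bracket: "vector_field B X \<Longrightarrow> vector_field B Y \<Longrightarrow>
    dp x (lie_bracket A (lift X) (lift Y) x) = lie_bracket B X Y (p x)"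
  by (rule lie_bracket_related) (simp_all add: vector_field_lift dp_lift)

text \<open>Inner products of lifts are functions pulled back from N, and brackets of lifts project
  to brackets on N. Hence all six Koszul terms at x equal those on N at p x.\<close>

lemma koszul_lift:
  assumes X: "vector_field B X" and Y: "vector_field B Y" and Z: "vector_field B Z"
  shows "g x (D (lift X) (lift Y) x) (lift Z x) = g' (p x) (D' X Y (p x)) (Z (p x))"
proof -
  have lifted: "(\<lambda>y. g y (lift U y) (lift V y)) = (\<lambda>y. g' (p y) (U (p y)) (V (p y)))" for U V
    by (simp add: g_hor_left lift_hor dp_lift)
  have ap: "vf_apply A (lift U) (\<lambda>y. g' (p y) (V (p y)) (W (p y))) x = vf_apply B U (\<lambda>y. g' y (V y) (W y)) (p x)"
    if "vector_field B V" "vector_field B W" for U V W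
    by (rule vf_apply_comp[OF N.smooth_fun_metric[OF N.g that] dp_lift])
  have br: "g x (lie_bracket A (lift U) (lift V) x) (lift W x) = g' (p x) (lie_bracket B U V (p x)) (W (p x))"
    if "vector_field B U" "vector_field B V" for U V W
    by (simp add: g_hor_right lift_hor dp_lift lift_bracket that)
  note vl = vector_field_lift
  show ?thesis
    using M.koszul[OF vl[OF X] vl[OF Y] vl[OF Z], of x] N.koszul[OF X Y Z, of "p x"]
    unfolding lifted by (simp only: ap br X Y Z)
qed

text \<open>Nondegeneracy: the test field is chosen to equal the difference of the two sides at p x,
  which makes that difference orthogonal to itself.\<close>

lemma dp_D_lift:
  assumes X: "vector_field B X" and Y: "vector_field B Y"
  shows "dp x (D (lift X) (lift Y) x) = D' X Y (p x)"
proof -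
  let ?E = "dp x (D (lift X) (lift Y) x) - D' X Y (p x)"
  obtain Z where Z: "vector_field B Z" "Z (p x) = ?E" using N.exists_vector_field by blast
  have "g' (p x) (dp x (D (lift X) (lift Y) x)) (Z (p x)) = g' (p x) (D' X Y (p x)) (Z (p x))"
    using koszul_lift[OF X Y Z(1), of x] by (simp add: g_hor_right lift_hor dp_lift)
  then have "g' (p x) ?E ?E = 0" using Z(2) by (simp add: N.g_simps)
  then show ?thesis using N.g_self_eq_0 by fastforce
qed

text \<open>For smooth X and Y this is O'Neill's A on the two lifts: by \<open>dp_D_lift\<close> the
  subtracted field is the horizontal part. This form makes the computations free of
  projections.\<close>

definition oneill_basic :: "('n \<Rightarrow> 'f) \<Rightarrow> ('n \<Rightarrow> 'f) \<Rightarrow> 'm \<Rightarrow> 'e" where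
  "oneill_basic X Y x = D (lift X) (lift Y) x - lift (D' X Y) x"

lemma oneill_basic_eq_vproj: "vector_field B X \<Longrightarrow> vector_field B Y \<Longrightarrow>
    oneill_basic X Y x = vproj A B g p (D (lift X) (lift Y)) x"
  by (simp add: oneill_basic_def vproj_eq dp_D_lift lift_def)

lemma vf_apply_zero: "vf_apply A X (\<lambda>y. 0) x = 0"
  by (simp add: vf_apply_def o_def)

text \<open>Metric compatibility moves the outer derivative onto W. The derivative of the inner
  product descends to N, and \<open>g_split\<close> separates the remaining product into its part on
  N and its part in A.\<close>

lemma second_derivative_lift:
  assumes X: "vector_field B X" and Y: "vector_field B Y" and Z: "vector_field B Z" and W: "vector_field B W"
  shows "g x (D (lift X) (D (lift Y) (lift Z)) x) (lift W x) =
    g' (p x) (D' X (D' Y Z) (p x)) (W (p x)) - g x (oneill_basic Y Z x) (oneill_basic X W x)"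
proof -
  note vl = vector_field_lift
  have "vf_apply A (lift X) (\<lambda>y. g y (D (lift Y) (lift Z) y) (lift W y)) x =
      vf_apply B X (\<lambda>y. g' y (D' Y Z y) (W y)) (p x)"
    unfolding koszul_lift[OF Y Z W]
    by (rule vf_apply_comp[OF N.smooth_fun_metric[OF N.g N.D_vf[OF Y Z] W] dp_lift])
  moreover have "g x (D (lift Y) (lift Z) x) (D (lift X) (lift W) x) =
      g' (p x) (D' Y Z (p x)) (D' X W (p x)) + g x (oneill_basic Y Z x) (oneill_basic X W x)"
    by (subst g_split) (simp add: dp_D_lift X Y Z W oneill_basic_def lift_def)
  ultimately show ?thesis
    using M.vf_apply_metric[OF vl[OF X] M.D_vf[OF vl[OF Y] vl[OF Z]] vl[OF W], of x]
      N.vf_apply_metric[OF X N.D_vf[OF Y Z] W, of "p x"] by simp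
qed

text \<open>V is related to the zero field, so its bracket with a lift is vertical and V and the
  lift of Z may be exchanged under the product with a lift. Differentiating g(V, W) = 0 along Z then
  moves the derivative onto W, where only the vertical part counts.\<close>

lemma D_vertical_lift:
  assumes V: "vector_field A V" "\<And>x. dp x (V x) = 0" and Z: "vector_field B Z" and W: "vector_field B W"
  shows "g x (D V (lift Z) x) (lift W x) = - g x (V x) (oneill_basic Z W x)"
proof -
  note vl = vector_field_lift
  have "dp x (lie_bracket A V (lift Z) x) = lie_bracket B (\<lambda>x. 0) Z (p x)"
    by (rule lie_bracket_related) (simp_all add: V vl Z dp_lift N.vector_field_zero)
  then have "g x (lie_bracket A V (lift Z) x) (lift W x) = 0"
    by (simp add: N.lie_bracket_zero Z g_hor_right lift_hor N.g_simps)
  then have 1: "g x (D V (lift Z) x) (lift W x) = g x (D (lift Z) V x) (lift W x)"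
    by (simp add: M.lie_bracket_eq V vl Z M.g_simps)
  have "(\<lambda>y. g y (V y) (lift W y)) = (\<lambda>y. 0)"
    by (simp add: g_hor_right lift_hor V N.g_simps)
  then have 2: "g x (D (lift Z) V x) (lift W x) = - g x (V x) (D (lift Z) (lift W) x)"
    using M.vf_apply_metric[OF vl[OF Z] V(1) vl[OF W], of x] by (simp add: vf_apply_zero)
  have "g x (V x) (D (lift Z) (lift W) x) = g x (V x) (oneill_basic Z W x)"
    by (subst g_split) (simp add: V hlift_0 N.g_simps dp_D_lift Z W oneill_basic_def lift_def)
  with 1 2 show ?thesis by simp
qed

text \<open>The bracket of two lifts is the lift of the bracket plus a vertical remainder, which
  torsion-freeness identifies as A_X Y - A_Y X. The two parts are handled by
  \<open>koszul_lift\<close> and \<open>D_vertical_lift\<close>.\<close>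

lemma D_bracket_lift:
  assumes X: "vector_field B X" and Y: "vector_field B Y" and Z: "vector_field B Z" and W: "vector_field B W"
  shows "g x (D (lie_bracket A (lift X) (lift Y)) (lift Z) x) (lift W x) =
    g' (p x) (D' (lie_bracket B X Y) Z (p x)) (W (p x))
    - g x (oneill_basic X Y x - oneill_basic Y X x) (oneill_basic Z W x)"
proof -
  note vl = vector_field_lift
  let ?V = "\<lambda>x. lie_bracket A (lift X) (lift Y) x - lift (lie_bracket B X Y) x"
  note b = N.vector_field_lie_bracket[OF X Y]
  have V: "vector_field A ?V"
    by (intro M.vector_field_diff M.vector_field_lie_bracket vl X Y b)
  have dV: "dp x (?V x) = 0" for x by (simp add: dp_simps lift_bracket X Y dp_lift)
  have "D (lie_bracket A (lift X) (lift Y)) (lift Z) x = D ?V (lift Z) x + D (lift (lie_bracket B X Y)) (lift Z) x"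
    using M.D_add_left[OF V vl[OF b] vl[OF Z]] by simp
  moreover have "?V x = oneill_basic X Y x - oneill_basic Y X x"
  proof -
    have "lift (lie_bracket B X Y) x = lift (D' X Y) x - lift (D' Y X) x"
      unfolding lift_def[of "lie_bracket B X Y"]
      by (rule hlift_eqI) (simp_all add: hor_diff lift_hor dp_simps dp_lift N.lie_bracket_eq X Y)
    then show ?thesis by (simp add: oneill_basic_def M.lie_bracket_eq vl X Y)
  qed
  ultimately show ?thesis
    using D_vertical_lift[OF V dV Z W, of x] koszul_lift[OF b Z W, of x] by (simp add: M.g_simps)
qed

text \<open>The three corrections come, in this order, from D_X D_Y Z, from D_Y D_X Z and from the
  vertical part of the bracket.\<close>

lemma curvature_lift:
  assumes X: "vector_field B X" and Y: "vector_field B Y" and Z: "vector_field B Z" and W: "vector_field B W"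
  shows "curvature A g D (lift X) (lift Y) (lift Z) (lift W) x = curvature B g' D' X Y Z W (p x)
    - g x (oneill_basic Y Z x) (oneill_basic X W x) + g x (oneill_basic X Z x) (oneill_basic Y W x)
    + g x (oneill_basic X Y x - oneill_basic Y X x) (oneill_basic Z W x)"
  unfolding curvature_def
  using second_derivative_lift[OF X Y Z W, of x] second_derivative_lift[OF Y X Z W, of x]
    D_bracket_lift[OF X Y Z W, of x]
  by (simp add: M.g_simps N.g_simps)

text \<open>The second summand of A differentiates the vertical part of Y, which is the zero
  field.\<close>

lemma oneill_A_horizontal:
  assumes "horizontal_field A B g p X" "horizontal_field A B g p Y"
  shows "oneill_A A B g D p X Y x = vproj A B g p (D X Y) x"
proof -
  have h: "hproj A B g p Z = Z" if "horizontal_field A B g p Z" for Z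
  proof
    fix y show "hproj A B g p Z y = Z y"
      unfolding hproj_eq by (rule hlift_eqI) (use that in \<open>auto simp: horizontal_field_def\<close>)
  qed
  then have v: "vproj A B g p Y = (\<lambda>y. 0)"
    using assms(2) by (simp add: fun_eq_iff vproj_eq hproj_eq)
  show ?thesis
    using assms M.D_zero_right[of X]
    by (simp add: oneill_A_def Let_def h v hproj_eq dp_simps hlift_0 horizontal_field_def)
qed

end

section \<open>Algebra of phi on horizontal vectors and transfer of the curvature identity\<close>

theorem proposition3p8:
  fixes AM :: "('m::{t2_space,second_countable_topology}, 'e::euclidean_space) chart set"
    and \<phi> :: "'m \<Rightarrow> 'e \<Rightarrow> 'e" and \<xi> :: "'m \<Rightarrow> 'e" and \<eta> :: "'m \<Rightarrow> 'e \<Rightarrow> real"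
    and g :: "'m \<Rightarrow> 'e \<Rightarrow> 'e \<Rightarrow> real"
    and AN :: "('n::{t2_space,second_countable_topology}, 'f::euclidean_space) chart set"
    and J :: "'n \<Rightarrow> 'f \<Rightarrow> 'f" and g' :: "'n \<Rightarrow> 'f \<Rightarrow> 'f \<Rightarrow> real"
    and \<pi> :: "'m \<Rightarrow> 'n"
    and DM :: "('m \<Rightarrow> 'e) \<Rightarrow> ('m \<Rightarrow> 'e) \<Rightarrow> ('m \<Rightarrow> 'e)"
    and DN :: "('n \<Rightarrow> 'f) \<Rightarrow> ('n \<Rightarrow> 'f) \<Rightarrow> ('n \<Rightarrow> 'f)"
  assumes "contact_complex_submersion AM \<phi> \<xi> \<eta> g AN J g' \<pi>"
    and "levi_civita AM g DM" and "levi_civita AN g' DN"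
    and "\<And>X Y. horizontal_field AM AN g \<pi> X \<Longrightarrow> horizontal_field AM AN g \<pi> Y \<Longrightarrow>
           oneill_A AM AN g DM \<pi> X (\<lambda>x. \<phi> x (Y x)) = oneill_A AM AN g DM \<pi> (\<lambda>x. \<phi> x (X x)) Y"
    and "K3phi AM \<phi> g DM"
  shows "K3 AN J g' DN"
proof -
  have con: "almost_contact_metric AM \<phi> \<xi> \<eta> g" and her: "almost_hermitian AN J g'"
    and sub: "riemannian_submersion AM AN g g' \<pi>"
    and J\<phi>: "J (\<pi> x) (differential AM AN \<pi> x v) = differential AM AN \<pi> x (\<phi> x v)" for x v
    using assms(1) by (simp_all add: contact_complex_submersion_def)
  interpret riemannian_submersion_between AM AN \<pi> g DM g' DN
    by unfold_locales
       (use con her sub assms(2,3) in \<open>auto simp: almost_contact_metric_def almost_hermitian_def riemannian_submersion_def\<close>)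
  have \<phi>: "endo_field AM \<phi>" and \<phi>\<phi>: "\<phi> x (\<phi> x v) = - v + \<eta> x v *\<^sub>R \<xi> x" and \<eta>\<xi>: "\<eta> x (\<xi> x) = 1"
    and g\<phi>: "g x (\<phi> x u) (\<phi> x v) = g x u v - \<eta> x u * \<eta> x v" for x u v
    using con by (simp_all add: almost_contact_metric_def)
  have J: "endo_field AN J" and JJ: "J y (J y v) = - v" for y v
    using her by (simp_all add: almost_hermitian_def)
  have lin\<phi>: "linear (\<phi> x)" for x using \<phi> by (simp add: endo_field_def)
  have linJ: "linear (J y)" for y using J by (simp add: endo_field_def)
  \<comment> \<open>From phi^2 xi = 0, the formula for phi^2 at phi xi gives phi xi = c xi. Applying
    phi yields 0 = c phi xi, so either c or phi xi vanishes, and both cases give phi xi = 0.\<close>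
  have \<phi>\<xi>: "\<phi> x (\<xi> x) = 0" for x
  proof -
    have 0: "\<phi> x (\<phi> x (\<xi> x)) = 0" by (simp add: \<phi>\<phi> \<eta>\<xi>)
    then have 1: "\<phi> x (\<xi> x) = \<eta> x (\<phi> x (\<xi> x)) *\<^sub>R \<xi> x"
      using \<phi>\<phi>[of x "\<phi> x (\<xi> x)"] linear_0[OF lin\<phi>] by simp
    have "0 = \<eta> x (\<phi> x (\<xi> x)) *\<^sub>R \<phi> x (\<xi> x)"
      using 0 1 linear_scale[OF lin\<phi>, of x] by metis
    with 1 show ?thesis by auto
  qed
  have dp\<xi>: "dp x (\<xi> x) = 0" for x
  proof -
    have "J (\<pi> x) (dp x (\<xi> x)) = 0" by (simp add: J\<phi> \<phi>\<xi> dp_simps)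
    then show ?thesis using JJ[of "\<pi> x" "dp x (\<xi> x)"] linear_0[OF linJ] by simp
  qed
  have \<eta>: "\<eta> x u = g x u (\<xi> x)" for x u
    using g\<phi>[of x u "\<xi> x"] by (simp add: \<phi>\<xi> \<eta>\<xi> M.g_simps)
  have \<eta>0: "\<eta> x u = 0" if "u \<in> hor x" for x u
    using hor_orth[OF that dp\<xi>] by (simp add: \<eta>)
  \<comment> \<open>Evaluate phi^3 u in two ways, as phi of phi^2 u and as phi^2 of phi u; the
    difference is the xi-component of phi u.\<close>
  have \<eta>\<phi>: "\<eta> x (\<phi> x u) = 0" for x u
  proof -
    have "\<phi> x (\<phi> x (\<phi> x u)) = - \<phi> x u"
      unfolding \<phi>\<phi>[of x u] by (simp add: linear_diff[OF lin\<phi>] linear_scale[OF lin\<phi>] \<phi>\<xi>)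
    then have "\<eta> x (\<phi> x u) *\<^sub>R \<xi> x = 0" using \<phi>\<phi>[of x "\<phi> x u"] by simp
    then show ?thesis using \<eta>\<xi>[of x] by (auto simp: \<eta> M.g_simps)
  qed
  \<comment> \<open>For vertical v, phi v is vertical, so g(phi u, phi (phi v)) = g(u, phi v) = 0.
    As phi^2 v differs from -v by a multiple of xi, to which phi u is orthogonal, phi u is
    orthogonal to v.\<close>
  have \<phi>hor: "\<phi> x u \<in> hor x" if u: "u \<in> hor x" for x u
    unfolding horizontal_def
  proof safe
    fix v assume "v \<in> ver x"
    then have "dp x (\<phi> x v) = 0" using J\<phi>[of x v] linear_0[OF linJ] by (simp add: ver_iff)
    then have "g x (\<phi> x u) (\<phi> x (\<phi> x v)) = 0"
      by (simp add: g\<phi> \<eta>0[OF u] hor_orth[OF u])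
    then show "g x (\<phi> x u) v = 0" using \<eta>\<phi>[of x u] by (simp add: \<phi>\<phi> M.g_simps \<eta>)
  qed
  have \<phi>\<phi>hor: "\<phi> x (\<phi> x u) = - u" if "u \<in> hor x" for x u
    using that by (simp add: \<phi>\<phi> \<eta>0)
  have liftJ: "lift (\<lambda>y. J y (X y)) = (\<lambda>x. \<phi> x (lift X x))" for X
  proof
    fix x show "lift (\<lambda>y. J y (X y)) x = \<phi> x (lift X x)"
      unfolding lift_def[of "\<lambda>y. J y (X y)"]
      by (rule hlift_eqI) (simp_all add: \<phi>hor lift_hor J\<phi>[symmetric] dp_lift)
  qed
  note vJ = N.vector_field_endo[OF J] and hf = horizontal_field_lift
  have oneill_basicJ: "oneill_basic (\<lambda>y. J y (X y)) (\<lambda>y. J y (Y y)) x = - oneill_basic X Y x"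
    if X: "vector_field AN X" and Y: "vector_field AN Y" for X Y x
  proof -
    have "oneill_basic (\<lambda>y. J y (X y)) (\<lambda>y. J y (Y y)) x =
        oneill_A AM AN g DM \<pi> (\<lambda>x. \<phi> x (lift X x)) (lift (\<lambda>y. J y (Y y))) x"
      unfolding liftJ[of X, symmetric]
      by (simp add: oneill_basic_eq_vproj oneill_A_horizontal hf vJ X Y)
    \<comment> \<open>The hypothesis is read from right to left, for the lifts of X and JY: it moves
      phi to the second slot, where it meets the phi already contained in the lift of JY.\<close>
    also have "\<dots> = oneill_A AM AN g DM \<pi> (lift X) (\<lambda>x. \<phi> x (lift (\<lambda>y. J y (Y y)) x)) x"
      using assms(4)[OF hf[OF X] hf[OF vJ[OF Y]]] by simp
    also have "\<dots> = oneill_A AM AN g DM \<pi> (lift X) (\<lambda>x. - lift Y x) x"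
      by (simp add: liftJ \<phi>\<phi>hor lift_hor)
    also have "\<dots> = vproj AM AN g \<pi> (DM (lift X) (\<lambda>x. - lift Y x)) x"
    proof (rule oneill_A_horizontal[OF hf[OF X]])
      show "horizontal_field AM AN g \<pi> (\<lambda>x. - lift Y x)"
        using hf[OF Y] by (auto simp: horizontal_field_def M.vector_field_uminus horizontal_def M.g_simps)
    qed
    also have "\<dots> = - DM (lift X) (lift Y) x - hlift x (- DN X Y (\<pi> x))"
      by (simp add: vproj_eq M.D_uminus_right vector_field_lift X Y dp_simps dp_D_lift)
    also have "hlift x (- DN X Y (\<pi> x)) = - lift (DN X Y) x"
      using lift_hor[of "DN X Y" x]
      by (intro hlift_eqI) (auto simp: horizontal_def M.g_simps dp_simps dp_lift)
    finally show ?thesis by (simp add: oneill_basic_def)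
  qed
  show ?thesis
    unfolding K3_def curvature_invariant_def
  proof (intro allI impI)
    fix X Y Z W y
    assume v: "vector_field AN X" "vector_field AN Y" "vector_field AN Z" "vector_field AN W"
    \<comment> \<open>Lifts are compared along fibres, so the identity at y is read off at any one
      preimage of y.\<close>
    obtain x where x: "y = \<pi> x" using sub unfolding riemannian_submersion_def by (metis surjD)
    have "curvature AM g DM (lift X) (lift Y) (lift Z) (lift W) x =
      curvature AM g DM (lift (\<lambda>y. J y (X y))) (lift (\<lambda>y. J y (Y y))) (lift (\<lambda>y. J y (Z y))) (lift (\<lambda>y. J y (W y))) x"
      using assms(5) v unfolding liftJ K3phi_def curvature_invariant_def by (simp add: vector_field_lift)
    then show "curvature AN g' DN X Y Z W y =
      curvature AN g' DN (\<lambda>y. J y (X y)) (\<lambda>y. J y (Y y)) (\<lambda>y. J y (Z y)) (\<lambda>y. J y (W y)) y"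
      unfolding curvature_lift[OF v] curvature_lift[OF vJ[OF v(1)] vJ[OF v(2)] vJ[OF v(3)] vJ[OF v(4)]]
      by (simp add: oneill_basicJ v M.g_simps x)
  qed
qed

end
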